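(* Let $(\alpha,p)\in\Pi_2\cup\Pi_3$. Then there exists a function $F:\mathbb{T}\to\mathbb{C}$, absolutely continuous on $\mathbb{T}$ with $\dot F\in\mathcal{L}^p(\mathbb{T})$, such that the mapping $f=\mathcal{K}_\alpha[F]$ in $\mathbb{D}$ satisfies $$H_p(\partial_{r}f)=H_p(\partial_{z}f)=H_p(\partial_{\overline{z}}f)=\infty.$$
   Context: $\mathbb{D}=\{z\in\mathbb{C}:|z|<1\}$, $\mathbb{T}=\partial\mathbb{D}$. Parameter sets: $\Pi_2=\{(\alpha,p):-1<\alpha<0,\ 1\le p<-\frac1\alpha\}\cup\{(0,1)\}$; $\Pi_3=\{(\alpha,p):-1<\alpha<0,\ -\frac1\alpha\le p\le\infty\}\cup\{(0,\infty)\}$. Poisson type integral: for $\alpha>-1$ and $F\in\mathcal{L}^1(\mathbb{T})$, $$\mathcal{K}_{\alpha}[F](z)=\frac{1}{2\pi}\int_{0}^{2\pi}\mathcal{K}_{\alpha}(ze^{-it})F(e^{it})\,dt,\quad \mathcal{K}_{\alpha}(z)=\mathcal{C}_{\alpha}\frac{(1-|z|^2)^{\alpha+1}}{|1-z|^{\alpha+2}},\quad \mathcal{C}_{\alpha}=\frac{\Gamma^2(1+\frac{\alpha}{2})}{\Gamma(1+\alpha)},\quad z\in\mathbb{D}.$$ Absolute continuity of $F$ on $\mathbb{T}$ refers to $\theta\mapsto F(e^{i\theta})$ on $[0,2\pi]$, and $\dot F(e^{i\theta})=\frac{d}{d\theta}F(e^{i\theta})$, which exists a.e. $\mathcal{L}^p(\mathbb{T})$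 is the usual Lebesgue space on $\mathbb{T}$. Derivatives: $\partial_z=\frac12(\partial_x-i\partial_y)$, $\partial_{\overline z}=\frac12(\partial_x+i\partial_y)$, and for $z=re^{i\theta}$, $\partial_r f(z)=\partial_zf(z)e^{i\theta}+\partial_{\overline z}f(z)e^{-i\theta}$. For a measurable complex-valued $g$ on $\mathbb{D}$, $H_p(g)=\sup_{r\in[0,1)}M_p(r,g)$, where $M_p(r,g)=\big(\frac1{2\pi}\int_0^{2\pi}|g(re^{i\theta})|^p\,d\theta\big)^{1/p}$ for $p<\infty$ and $M_\infty(r,g)=\max_{\theta\in[0,2\pi]}|g(re^{i\theta})|$. *)

theory Defs
  imports "HOL-Analysis.Analysis"
begin

definition \<Pi>\<^sub>2 :: "(real \<times> ereal) set" where
  "\<Pi>\<^sub>2 = {(\<alpha>, p). -1 < \<alpha> \<and> \<alpha> < 0 \<and> 1 \<le> p \<and> p < ereal (- 1 / \<alpha>)} \<union> {(0, 1)}"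

definition \<Pi>\<^sub>3 :: "(real \<times> ereal) set" where
  "\<Pi>\<^sub>3 = {(\<alpha>, p). -1 < \<alpha> \<and> \<alpha> < 0 \<and> ereal (- 1 / \<alpha>) \<le> p \<and> p \<le> \<infinity>} \<union> {(0, \<infinity>)}"

text \<open>Functions on the unit circle are rendered as total functions \<open>complex \<Rightarrow> complex\<close>; only
  their values at points \<open>cis t\<close> are ever used.\<close>

definition poisson_const :: "real \<Rightarrow> real" where
  "poisson_const \<alpha> = (Gamma (1 + \<alpha> / 2))\<^sup>2 / Gamma (1 + \<alpha>)"

definition poisson_kernel :: "real \<Rightarrow> complex \<Rightarrow> real" where
  "poisson_kernel \<alpha> z =
     poisson_const \<alpha> * ((1 - (norm z)\<^sup>2) powr (\<alpha> + 1) / norm (1 - z) powr (\<alpha> + 2))"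

definition poisson_integral :: "real \<Rightarrow> (complex \<Rightarrow> complex) \<Rightarrow> complex \<Rightarrow> complex" where
  "poisson_integral \<alpha> F z =
     complex_of_real (1 / (2 * pi)) *
       (LINT t|lebesgue_on {0..2 * pi}. complex_of_real (poisson_kernel \<alpha> (z * cis (- t))) * F (cis t))"

definition abs_continuous_on_interval :: "real \<Rightarrow> real \<Rightarrow> (real \<Rightarrow> complex) \<Rightarrow> bool" where
  "abs_continuous_on_interval a b f \<longleftrightarrow>
     (\<forall>\<epsilon>>0. \<exists>\<delta>>0. \<forall>(n::nat) (u::nat \<Rightarrow> real) (v::nat \<Rightarrow> real).
        (\<forall>k<n. a \<le> u k \<and> u k \<le> v k \<and> v k \<le> b) \<longrightarrow>
        disjoint_family_on (\<lambda>k. {u k<..<v k}) {..<n} \<longrightarrow>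
        (\<Sum>k<n. v k - u k) < \<delta> \<longrightarrow>
        (\<Sum>k<n. norm (f (v k) - f (u k))) < \<epsilon>)"

definition abs_continuous_circle :: "(complex \<Rightarrow> complex) \<Rightarrow> bool" where
  "abs_continuous_circle F \<longleftrightarrow> abs_continuous_on_interval 0 (2 * pi) (\<lambda>\<theta>. F (cis \<theta>))"

text \<open>At \<open>\<zeta> = cis \<theta>\<close> this is the derivative of \<open>\<lambda>t. F (cis t)\<close> at \<open>\<theta>\<close>, since
  \<open>\<zeta> * cis s = cis (\<theta> + s)\<close>. Where the derivative does not exist (a null set if \<open>F\<close> is absolutely
  continuous) the value is an irrelevant junk value.\<close>

definition circle_deriv :: "(complex \<Rightarrow> complex) \<Rightarrow> complex \<Rightarrow> complex" where
  "circle_deriv F \<zeta> = vector_derivative (\<lambda>s. F (\<zeta> * cis s)) (at 0)"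

definition in_Lp_circle :: "ereal \<Rightarrow> (complex \<Rightarrow> complex) \<Rightarrow> bool" where
  "in_Lp_circle p g \<longleftrightarrow>
     (\<lambda>t. g (cis t)) \<in> borel_measurable (lebesgue_on {0..2 * pi}) \<and>
     (if p = \<infinity> then \<exists>C. AE t in lebesgue_on {0..2 * pi}. norm (g (cis t)) \<le> C
      else integrable (lebesgue_on {0..2 * pi}) (\<lambda>t. norm (g (cis t)) powr real_of_ereal p))"

definition partial_x :: "(complex \<Rightarrow> complex) \<Rightarrow> complex \<Rightarrow> complex" where
  "partial_x f z = vector_derivative (\<lambda>t. f (z + complex_of_real t)) (at 0)"

definition partial_y :: "(complex \<Rightarrow> complex) \<Rightarrow> complex \<Rightarrow> complex" where
  "partial_y f z = vector_derivative (\<lambda>t. f (z + \<i> * complex_of_real t)) (at 0)"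

definition partial_z :: "(complex \<Rightarrow> complex) \<Rightarrow> complex \<Rightarrow> complex" where
  "partial_z f z = (partial_x f z - \<i> * partial_y f z) / 2"

definition partial_zbar :: "(complex \<Rightarrow> complex) \<Rightarrow> complex \<Rightarrow> complex" where
  "partial_zbar f z = (partial_x f z + \<i> * partial_y f z) / 2"

text \<open>\<open>\<theta> = Arg z\<close> gives \<open>z = r e\<^sup>i\<^sup>\<theta>\<close>. At \<open>z = 0\<close>, where the angle is not determined by \<open>z\<close>, the
  convention is \<open>\<theta> = Arg 0 = 0\<close>; this single point affects no more than the mean at \<open>r = 0\<close>, which
  is finite for every choice.\<close>

definition partial_r :: "(complex \<Rightarrow> complex) \<Rightarrow> complex \<Rightarrow> complex" where
  "partial_r f z = partial_z f z * cis (Arg z) + partial_zbar f z * cis (- Arg z)"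

definition ennreal_powr :: "ennreal \<Rightarrow> real \<Rightarrow> ennreal" where
  "ennreal_powr x a = (if x = \<infinity> then \<infinity> else ennreal (enn2real x powr a))"  \<comment> \<open>used for \<open>a > 0\<close>\<close>

definition integral_mean :: "ereal \<Rightarrow> real \<Rightarrow> (complex \<Rightarrow> complex) \<Rightarrow> ennreal" where
  "integral_mean p r g =
     (if p = \<infinity> then SUP \<theta>\<in>{0..2 * pi}. ennreal (norm (g (complex_of_real r * cis \<theta>)))
      else ennreal_powr
             (ennreal (1 / (2 * pi)) *
               (\<integral>\<^sup>+ \<theta>. ennreal (norm (g (complex_of_real r * cis \<theta>)) powr real_of_ereal p)
                  \<partial>lebesgue_on {0..2 * pi}))
             (1 / real_of_ereal p))"

definition hardy_norm :: "ereal \<Rightarrow> (complex \<Rightarrow> complex) \<Rightarrow> ennreal" where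
  "hardy_norm p g = (SUP r\<in>{0..<1}. integral_mean p r g)"

end

theory Submission
  imports Defs "HOL-Complex_Analysis.Cauchy_Integral_Formula"
begin

text \<open>
  \<^bold>\<open>Negative \<open>\<alpha>\<close>.\<close> Already the constant function \<open>F = 1\<close> works, for every \<open>p\<close>. Its Poisson type integral is
  radial. By Parseval, applied to the binomial series of \<open>(1 - w) powr (-s)\<close> with \<open>s = 1 + \<alpha>/2\<close>, it equals
  \<open>\<phi>(|z|\<^sup>2)\<close> with \<open>\<phi>(x) = C (1 - x) powr (\<alpha> + 1) * (\<Sum>n. c\<^sub>n\<^sup>2 x^n)\<close>, \<open>c\<^sub>n = (s)\<^sub>n / n!\<close>. The recursion of the
  \<open>c\<^sub>n\<close> turns the derivative into \<open>C (1 - x) powr \<alpha> * (\<Sum>n. c\<^sub>n\<^sup>2 (s - 1)\<^sup>2 / (n + 1) * x^n)\<close>. All terms of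
  this series are nonnegative and the first one is \<open>(\<alpha>/2)\<^sup>2 > 0\<close>, so \<open>\<phi>'(x)\<close> grows at least like
  \<open>(1 - x) powr \<alpha>\<close> and the three derivatives tend to infinity uniformly on the circles \<open>|z| = r\<close>
  (\<open>radial_profile_derivative\<close>, \<open>hardy_norm_poisson_integral_one\<close>).

  \<^bold>\<open>The classical case \<open>\<alpha> = 0\<close>.\<close> Here \<open>f\<close> is the harmonic extension of \<open>F\<close>. If \<open>f = Re h\<close> with \<open>h\<close> holomorphic,
  then \<open>\<partial>\<^sub>z f = h'/2\<close>, the derivative with respect to the conjugate variable is the conjugate of this,
  \<open>\<partial>\<^sub>r f = Re (h' e^(i\<theta>))\<close>, and the boundary derivative of \<open>F\<close> is \<open>- Im (z h')\<close>. The task is thus to find a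
  holomorphic \<open>z h'\<close> whose imaginary part is tame on the circle while its real part is not: the
  failure of boundedness of the conjugate function at the endpoints \<open>p = 1\<close> and \<open>p = \<infinity>\<close>.

  For \<open>p = \<infinity>\<close> take \<open>h(z) = (1 - z) Log (1 - z)\<close>. Then \<open>h' = - Log (1 - z) - 1\<close>, so \<open>z h'\<close> has bounded imaginary part
  but is unbounded along the real axis.

  For \<open>p = 1\<close> take \<open>h(z) = - i Log (1 - Log (1 - z))\<close>. Its real part is continuous on the closed disc, and
  \<open>Im (z h')\<close> is bounded above on the circle. A continuous function on a compact interval that is
  differentiable in the interior, with derivative bounded on one side, is absolutely continuous
  (\<open>absolutely_continuous_if_derivative_bounded_below\<close>). On the other hand, by
  the Cauchy-Riemann equations the integral of \<open>Re (z h')\<close> over the upper half of the circle \<open>|z| = r\<close> is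
  \<open>Im h(-r) - Im h(r)\<close>, and this grows like \<open>log log (1/(1 - r))\<close>
  (\<open>hardy_norm_1_conjugate_unbounded\<close>).
\<close>

section \<open>Absolute continuity from an integrable derivative\<close>

text \<open>The increments of \<open>u\<close> over short intervals are controlled by splitting \<open>\<bar>D\<bar>\<close> into a bounded part
  \<open>min \<bar>D\<bar> N\<close>, which contributes at most \<open>N\<close> times the total length, and an excess of small integral,
  which contributes little over any family of disjoint intervals.\<close>

lemma abs_continuous_on_interval_of_real:
  fixes u D :: "real \<Rightarrow> real"
  assumes cont: "continuous_on {a..b} u"
    and der: "\<And>x. x \<in> {a<..<b} \<Longrightarrow> (u has_real_derivative D x) (at x)"
    and D: "D absolutely_integrable_on {a..b}"
  shows "abs_continuous_on_interval a b (\<lambda>x. complex_of_real (u x))"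
  unfolding abs_continuous_on_interval_def
proof (intro allI impI)
  fix \<epsilon> :: real assume "\<epsilon> > 0"
  have absD: "(\<lambda>x. \<bar>D x\<bar>) integrable_on {a..b}"
    using D unfolding absolutely_integrable_on_def by simp
  have trunc: "(\<lambda>x. min \<bar>D x\<bar> (real N)) integrable_on {a..b}" for N
  proof -
    have "(\<lambda>x. \<bar>D x\<bar>) absolutely_integrable_on {a..b}"
      using absD by (intro nonnegative_absolutely_integrable_1) auto
    moreover have "(\<lambda>x. real N) absolutely_integrable_on {a..b}"
      by (intro absolutely_integrable_continuous_real continuous_intros)
    ultimately have "(\<lambda>x. min \<bar>D x\<bar> (real N)) absolutely_integrable_on {a..b}"
      by (rule absolutely_integrable_min_1)
    then show ?thesis by (simp add: absolutely_integrable_on_def)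
  qed
  have "(\<lambda>N. integral {a..b} (\<lambda>x. min \<bar>D x\<bar> (real N))) \<longlonglongrightarrow> integral {a..b} (\<lambda>x. \<bar>D x\<bar>)"
  proof (rule dominated_convergence)
    fix x
    have "\<forall>\<^sub>F N in sequentially. min \<bar>D x\<bar> (real N) = \<bar>D x\<bar>"
      using eventually_ge_at_top[of "nat \<lceil>\<bar>D x\<bar>\<rceil>"] by eventually_elim linarith
    then show "(\<lambda>N. min \<bar>D x\<bar> (real N)) \<longlonglongrightarrow> \<bar>D x\<bar>"
      by (rule tendsto_eventually)
  qed (use absD trunc in auto)
  then have "\<forall>\<^sub>F N in sequentially. 
      dist (integral {a..b} (\<lambda>x. min \<bar>D x\<bar> (real N))) (integral {a..b} (\<lambda>x. \<bar>D x\<bar>)) < \<epsilon> / 2"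
    using \<open>\<epsilon> > 0\<close> by (intro tendstoD) auto
  then obtain N where N:
    "dist (integral {a..b} (\<lambda>x. min \<bar>D x\<bar> (real N))) (integral {a..b} (\<lambda>x. \<bar>D x\<bar>)) < \<epsilon> / 2"
    by (auto simp: eventually_sequentially)
  define w where "w = (\<lambda>x. \<bar>D x\<bar> - (min) \<bar>D x\<bar> (real N))"
  have w_nonneg: "0 \<le> w x" for x by (simp add: w_def)
  have w_int: "w integrable_on {a..b}"
    unfolding w_def by (intro integrable_diff absD trunc)
  have w_small: "integral {a..b} w < \<epsilon> / 2"
    using N absD trunc unfolding w_def dist_real_def by (subst integral_diff) (auto simp: abs_if split: if_splits)
  define \<delta> where "\<delta> = \<epsilon> / (2 * (real N + 1))"
  show "\<exists>\<delta>>0. \<forall>(n::nat) (l::nat \<Rightarrow> real) (v::nat \<Rightarrow> real).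
        (\<forall>k<n. a \<le> l k \<and> l k \<le> v k \<and> v k \<le> b) \<longrightarrow>
        disjoint_family_on (\<lambda>k. {l k<..<v k}) {..<n} \<longrightarrow>
        (\<Sum>k<n. v k - l k) < \<delta> \<longrightarrow>
        (\<Sum>k<n. norm (complex_of_real (u (v k)) - complex_of_real (u (l k)))) < \<epsilon>"
  proof (intro exI[of _ \<delta>] conjI allI impI)
    show "\<delta> > 0" using \<open>\<epsilon> > 0\<close> by (simp add: \<delta>_def)
    fix n :: nat and l v :: "nat \<Rightarrow> real"
    assume ord: "\<forall>k<n. a \<le> l k \<and> l k \<le> v k \<and> v k \<le> b"
      and disj: "disjoint_family_on (\<lambda>k. {l k<..<v k}) {..<n}"
      and short: "(\<Sum>k<n. v k - l k) < \<delta>"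
    have piece: "\<bar>u (v k) - u (l k)\<bar> \<le> integral {l k..v k} w + real N * (v k - l k)" if "k < n" for k
    proof -
      have k: "a \<le> l k" "l k \<le> v k" "v k \<le> b" using ord that by auto
      have sub: "{l k..v k} \<subseteq> {a..b}" using k by auto
      have D_int: "(D has_integral (u (v k) - u (l k))) {l k..v k}"
        using k by (intro fundamental_theorem_of_calculus_interior continuous_on_subset[OF cont sub])
          (auto intro!: der simp flip: has_real_derivative_iff_has_vector_derivative)
      moreover have w_N: "((\<lambda>x. w x + real N) has_integral (integral {l k..v k} w + real N * (v k - l k))) {l k..v k}"
        using k has_integral_const_real[of "real N" "l k" "v k"]
        by (intro has_integral_add integrable_integral integrable_on_subinterval[OF w_int sub])
          (auto simp: mult.commute)
      moreover have "norm (D x) \<le> w x + real N" for x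
        by (simp add: w_def min_def)
      ultimately have "norm (integral {l k..v k} D) \<le> integral {l k..v k} (\<lambda>x. w x + real N)"
        by (intro integral_norm_bound_integral has_integral_integrable) auto
      then have "norm (u (v k) - u (l k)) \<le> integral {l k..v k} w + real N * (v k - l k)"
        using D_int w_N by (simp add: integral_unique)
      then show ?thesis by simp
    qed
    have "(\<Sum>k<n. integral {l k..v k} w) \<le> integral {a..b} w"
    proof -
      let ?I = "\<lambda>k x. if x \<in> {l k<..<v k} then w x else 0"
      have eq: "integral {l k..v k} w = integral {a..b} (?I k)" and int: "?I k integrable_on {a..b}" if "k < n" for k
      proof -
        have sub: "{l k..v k} \<subseteq> {a..b}" "{l k<..<v k} \<subseteq> {a..b}" using ord that by auto
        then have "w integrable_on {l k..v k}" using integrable_on_subinterval[OF w_int] by blast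
        then have "w integrable_on {l k<..<v k}"
          by (simp add: integrable_on_open_interval_real)
        then show "?I k integrable_on {a..b}"
          using integrable_restrict_Int[of "{l k<..<v k}" w "{a..b}"] sub(2) by (metis inf.absorb_iff1)
        show "integral {l k..v k} w = integral {a..b} (?I k)"
          using sub(2) integral_open_interval_real[of "l k" "v k" w]
            integral_restrict_Int[of "{a..b}" "{l k<..<v k}" w] by (metis inf.absorb_iff1)
      qed
      have "(\<Sum>k<n. integral {l k..v k} w) = integral {a..b} (\<lambda>x. \<Sum>k<n. ?I k x)"
        using eq int by (subst integral_sum) auto
      also have "\<dots> \<le> integral {a..b} w"
      proof (rule integral_le)
        show "(\<lambda>x. \<Sum>k<n. ?I k x) integrable_on {a..b}" using int by (intro integrable_sum) auto
        fix x
        show "(\<Sum>k<n. ?I k x) \<le> w x"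
        proof (cases "\<exists>j<n. x \<in> {l j<..<v j}")
          case True
          then obtain j where j: "j < n" "x \<in> {l j<..<v j}" by blast
          have "?I k x = (if k = j then w x else 0)" if "k < n" for k
          proof (cases "k = j")
            case False
            then have "{l k<..<v k} \<inter> {l j<..<v j} = {}"
              using disj j that unfolding disjoint_family_on_def by blast
            then have "x \<notin> {l k<..<v k}" using j by blast
            then show ?thesis using False by (simp only: if_False)
          qed (use j in simp)
          then have "(\<Sum>k<n. ?I k x) = (\<Sum>k<n. if k = j then w x else 0)"
            by (intro sum.cong refl) blast
          then show ?thesis using j by simp
        next
          case False
          then have "(\<Sum>k<n. ?I k x) = 0" by (intro sum.neutral ballI if_not_P) blast
          then show ?thesis using w_nonneg by simp
        qed
      qed (rule w_int)
      finally show ?thesis .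
    qed
    moreover have "real N * (\<Sum>k<n. v k - l k) \<le> \<epsilon> / 2"
    proof -
      have "real N * (\<Sum>k<n. v k - l k) \<le> real N * \<delta>" using short by (intro mult_left_mono) auto
      also have "\<dots> \<le> \<epsilon> / 2" using \<open>\<epsilon> > 0\<close> by (simp add: \<delta>_def field_simps)
      finally show ?thesis .
    qed
    moreover have "(\<Sum>k<n. norm (complex_of_real (u (v k)) - complex_of_real (u (l k))))
        \<le> (\<Sum>k<n. integral {l k..v k} w + real N * (v k - l k))"
      using piece by (intro sum_mono) (simp flip: of_real_diff)
    ultimately show "(\<Sum>k<n. norm (complex_of_real (u (v k)) - complex_of_real (u (l k)))) < \<epsilon>"
      using w_small by (simp add: sum.distrib sum_distrib_left)
  qed
qed

lemma circle_deriv_cis: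
  fixes u :: "real \<Rightarrow> real"
  assumes F: "\<And>t. t \<in> {0..2*pi} \<Longrightarrow> F (cis t) = complex_of_real (u t)"
    and der: "(u has_real_derivative d) (at t)" and t: "t \<in> {0<..<2*pi}"
  shows "circle_deriv F (cis t) = complex_of_real d"
  unfolding circle_deriv_def
proof (rule vector_derivative_at)
  have "((\<lambda>s. u (t + s)) has_real_derivative d) (at 0)"
    using DERIV_shift[of u d 0 t] der by (simp add: add.commute)
  then have "((\<lambda>s. complex_of_real (u (t + s))) has_vector_derivative complex_of_real d) (at 0)"
    by (intro has_vector_derivative_of_real) (simp add: has_real_derivative_iff_has_vector_derivative)
  then show "((\<lambda>s. F (cis t * cis s)) has_vector_derivative complex_of_real d) (at 0)"
  proof (rule has_vector_derivative_transform_within_open)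
    show "complex_of_real (u (t + s)) = F (cis t * cis s)" if "s \<in> {-t<..<2*pi - t}" for s
      using F[of "t + s"] that by (simp add: cis_mult)
  qed (use t in auto)
qed

text \<open>The derivative of a function that is continuous on a closed interval and differentiable in its
  interior is always gauge integrable;
  a one-sided bound makes it absolutely integrable, because it then differs by a constant from a
  nonnegative gauge integrable function. So a continuous boundary function needs only a lower bound on
  its derivative to be absolutely continuous.\<close>

lemma absolutely_continuous_if_derivative_bounded_below:
  fixes u D :: "real \<Rightarrow> real"
  assumes F: "\<And>t. t \<in> {0..2*pi} \<Longrightarrow> F (cis t) = complex_of_real (u t)"
    and cont: "continuous_on {0..2*pi} u"
    and der: "\<And>t. t \<in> {0<..<2*pi} \<Longrightarrow> (u has_real_derivative D t) (at t)"
    and lower: "\<And>t. t \<in> {0<..<2*pi} \<Longrightarrow> - B \<le> D t"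
  shows "abs_continuous_circle F" and "in_Lp_circle 1 (circle_deriv F)"
    and "(\<And>t. t \<in> {0<..<2*pi} \<Longrightarrow> D t \<le> B) \<Longrightarrow> in_Lp_circle \<infinity> (circle_deriv F)"
proof -
  \<comment> \<open>Nothing is known about \<open>D\<close> at the endpoints, so it is replaced there by its lower bound.\<close>
  define E where "E = (\<lambda>t. if t \<in> {0<..<2*pi} then D t else - B)"
  have derE: "(u has_real_derivative E t) (at t)" if "t \<in> {0<..<2*pi}" for t
    using der[OF that] that by (simp add: E_def)
  have lowE: "0 \<le> E t + B" for t using lower[of t] by (auto simp: E_def)
  have "(E has_integral (u (2*pi) - u 0)) {0..2*pi}"
    using derE cont by (intro fundamental_theorem_of_calculus_interior)
      (auto simp: has_real_derivative_iff_has_vector_derivative)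
  then have "(\<lambda>t. E t + B) integrable_on {0..2*pi}"
    by (intro integrable_add integrable_const_ivl) (auto simp: integrable_on_def)
  then have "(\<lambda>t. E t + B) absolutely_integrable_on {0..2*pi}"
    using lowE by (intro nonnegative_absolutely_integrable_1) auto
  moreover have "(\<lambda>t. B) absolutely_integrable_on {0..2*pi}"
    by (intro absolutely_integrable_continuous_real continuous_intros)
  ultimately have "(\<lambda>t. E t + B - B) absolutely_integrable_on {0..2*pi}"
    by (rule set_integral_diff)
  then have absE: "E absolutely_integrable_on {0..2*pi}" by simp
  have "abs_continuous_on_interval 0 (2 * pi) (\<lambda>t. complex_of_real (u t))"
    using abs_continuous_on_interval_of_real[OF cont derE absE] by simp
  then show "abs_continuous_circle F"
    unfolding abs_continuous_circle_def abs_continuous_on_interval_def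
    using F by (smt (verit, ccfv_SIG) atLeastAtMost_iff lessThan_iff order_trans sum.cong)
  have intE: "integrable (lebesgue_on {0..2*pi}) E"
    using absE by (intro absolutely_integrable_imp_integrable) auto
  \<comment> \<open>The point \<open>1\<close>, where \<open>F\<close> need not be differentiable, is the image of both endpoints.\<close>
  have circ: "circle_deriv F (cis t) = (if t \<in> {0<..<2*pi} then complex_of_real (E t) else circle_deriv F 1)"
    if "t \<in> {0..2*pi}" for t
  proof (cases "t \<in> {0<..<2*pi}")
    case True
    then show ?thesis using circle_deriv_cis[OF F derE[OF True] True] by simp
  next
    case False
    then have "t = 0 \<or> t = 2 * pi" using that by auto
    then show ?thesis by auto
  qed
  have [measurable]: "E \<in> borel_measurable (lebesgue_on {0..2*pi})"
    using intE by (rule borel_measurable_integrable)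
  have "{t \<in> space (lebesgue_on {0..2*pi}). t \<in> {0<..<2*pi}} = {0<..<2*pi} \<inter> {0..2*pi}"
    by (auto simp: space_restrict_space)
  moreover have "{0<..<2*pi} \<inter> {0..2*pi} \<in> sets (lebesgue_on {0..2*pi})"
    by (auto simp: sets_restrict_space image_iff)
  ultimately have inner: "{t \<in> space (lebesgue_on {0..2*pi}). t \<in> {0<..<2*pi}} \<in> sets (lebesgue_on {0..2*pi})"
    by (simp only:)
  have meas: "(\<lambda>t. circle_deriv F (cis t)) \<in> borel_measurable (lebesgue_on {0..2*pi})"
  proof (subst measurable_cong[OF circ])
    show "(\<lambda>t. if t \<in> {0<..<2*pi} then complex_of_real (E t) else circle_deriv F 1)
        \<in> borel_measurable (lebesgue_on {0..2*pi})"
      by (rule measurable_If[OF _ _ inner]) auto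
  qed (auto simp: space_restrict_space)
  define K where "K = norm (circle_deriv F 1)"
  have "integrable (lebesgue_on {0..2*pi}) (\<lambda>t. norm (circle_deriv F (cis t)))"
  proof (rule Bochner_Integration.integrable_bound)
    show "integrable (lebesgue_on {0..2*pi}) (\<lambda>t. \<bar>E t\<bar> + K)"
      by (intro Bochner_Integration.integrable_add integrable_abs intE) (simp add: emeasure_restrict_space)
    show "AE t in lebesgue_on {0..2*pi}. norm (norm (circle_deriv F (cis t))) \<le> norm (\<bar>E t\<bar> + K)"
      by (intro AE_I2) (auto simp: circ K_def space_restrict_space)
  qed (use meas in measurable)
  then show "in_Lp_circle 1 (circle_deriv F)"
    using meas by (simp add: in_Lp_circle_def)
  assume upper: "\<And>t. t \<in> {0<..<2*pi} \<Longrightarrow> D t \<le> B"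
  have "norm (circle_deriv F (cis t)) \<le> \<bar>B\<bar> + K" if "t \<in> {0..2*pi}" for t
    using upper[of t] lower[of t] circ[OF that]
    by (cases "t \<in> {0<..<2*pi}") (auto simp: K_def E_def intro: add_increasing2)
  then have "AE t in lebesgue_on {0..2*pi}. norm (circle_deriv F (cis t)) \<le> \<bar>B\<bar> + K"
    by (intro AE_I2) (simp add: space_restrict_space)
  then show "in_Lp_circle \<infinity> (circle_deriv F)"
    using meas by (auto simp: in_Lp_circle_def)
qed

section \<open>Poisson integrals of real parts of holomorphic functions\<close>

text \<open>Cauchy's formula at the point \<open>z\<close> for the function \<open>w \<mapsto> h(w) (1 - |z|\<^sup>2) / (1 - z\<^sup>* w)\<close>, where \<open>z\<^sup>*\<close> is the
  conjugate of \<open>z\<close>: the extra factor is \<open>1\<close> at \<open>w = z\<close>, and on the unit circle it turns the Cauchy kernel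
  into the Poisson kernel.\<close>

lemma Poisson_formula_holomorphic:
  fixes h :: "complex \<Rightarrow> complex"
  assumes hol: "h holomorphic_on cball 0 1" and z: "norm z < 1"
  shows "((\<lambda>t. complex_of_real ((1 - (norm z)\<^sup>2) / (norm (1 - z * cis (- t)))\<^sup>2) * h (cis t))
           has_integral 2 * pi * h z) {0..2*pi}"
proof -
  have nz: "1 - cnj z * w \<noteq> 0" if "norm w \<le> 1" for w
  proof
    assume "1 - cnj z * w = 0"
    then have "norm (cnj z * w) = 1" by (metis eq_iff_diff_eq_0 norm_one)
    moreover have "norm z * norm w \<le> norm z" using that by (simp add: mult_left_le)
    ultimately show False using z by (simp add: norm_mult)
  qed
  define g where "g = (\<lambda>w. h w * of_real (1 - (norm z)\<^sup>2) / (1 - cnj z * w))"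
  have "g holomorphic_on cball 0 1"
    unfolding g_def using nz by (intro holomorphic_intros hol) auto
  then have "((\<lambda>w. g w / (w - z)) has_contour_integral (2 * of_real pi * \<i> * g z)) (circlepath 0 1)"
    using z Cauchy_integral_circlepath_simple[of g 0 1 z] by simp
  moreover have poly: "complex_of_real (1 - (norm z)\<^sup>2) = 1 - cnj z * z"
    by (simp only: of_real_diff of_real_1 complex_norm_square mult.commute)
  then have "g z = h z"
    using nz[of z] z unfolding g_def by (simp only: poly) simp
  ultimately have "((\<lambda>w. g w / (w - z)) has_contour_integral (2 * of_real pi * \<i> * h z)) (part_circlepath 0 1 0 (2*pi))"
    unfolding circlepath_def by simp
  then have "((\<lambda>t. g (cis t) / (cis t - z) * \<i> * cis t) has_integral (2 * of_real pi * \<i> * h z)) {0..2*pi}"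
    using has_contour_integral_part_circlepath_iff[of 0 "2*pi" "\<lambda>w. g w / (w - z)" "2 * of_real pi * \<i> * h z" 0 1]
    by simp
  then have "((\<lambda>t. - \<i> * (g (cis t) / (cis t - z) * \<i> * cis t)) has_integral - \<i> * (2 * of_real pi * \<i> * h z)) {0..2*pi}"
    by (rule has_integral_mult_right)
  moreover have "- \<i> * (g (cis t) / (cis t - z) * \<i> * cis t) =
      complex_of_real ((1 - (norm z)\<^sup>2) / (norm (1 - z * cis (- t)))\<^sup>2) * h (cis t)" for t
  proof -
    have ne: "cis t - z \<noteq> 0" using z by auto
    have "complex_of_real ((norm (1 - z * cis (- t)))\<^sup>2) = (1 - z * cis (-t)) * (1 - cnj z * cis t)"
      unfolding complex_norm_square by (simp add: cis_cnj)
    also have "\<dots> = (cis t - z) / cis t * (1 - cnj z * cis t)"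
      by (simp add: divide_inverse left_diff_distrib cis_mult)
    finally have "complex_of_real ((norm (1 - z * cis (- t)))\<^sup>2) = (cis t - z) / cis t * (1 - cnj z * cis t)" .
    moreover have cancel: "a \<noteq> 0 \<Longrightarrow> b \<noteq> 0 \<Longrightarrow> e \<noteq> 0 \<Longrightarrow> - \<i> * (H * c / b / a * \<i> * e) = c / (a / e * b) * H"
      for a b c e H :: complex by (simp add: field_simps)
    ultimately show ?thesis using nz[of "cis t"] ne
      unfolding g_def of_real_divide by (simp only:) (rule cancel, auto)
  qed
  moreover have "- \<i> * (2 * of_real pi * \<i> * h z) = 2 * of_real pi * h z"
    by (simp add: algebra_simps)
  ultimately show ?thesis by (simp only: of_real_mult of_real_numeral)
qed

text \<open>Only \<open>Re h\<close> has to extend continuously to the circle, \<open>h\<close> itself may be unbounded. The formula holds for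
  the dilations \<open>w \<mapsto> h(\<rho> w)\<close> with \<open>\<rho> < 1\<close>, and dominated convergence gives the limit \<open>\<rho> \<rightarrow> 1\<close>.\<close>

lemma poisson_integral_0_Re_holomorphic:
  fixes h :: "complex \<Rightarrow> complex"
  assumes hol: "h holomorphic_on ball 0 1" and cont: "continuous_on (cball 0 1) (\<lambda>z. Re (h z))"
    and F: "\<And>t. F (cis t) = complex_of_real (Re (h (cis t)))" and z: "norm z < 1"
  shows "poisson_integral 0 F z = complex_of_real (Re (h z))"
proof -
  define P where "P = (\<lambda>t. (1 - (norm z)\<^sup>2) / (norm (1 - z * cis (- t)))\<^sup>2)"
  have nz: "1 - z * cis (- t) \<noteq> 0" for t
    using z by (metis eq_iff_diff_eq_0 less_irrefl mult.right_neutral norm_cis norm_mult norm_one)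
  have contP: "continuous_on UNIV P"
    unfolding P_def using nz by (intro continuous_intros) auto
  have P_nonneg: "0 \<le> P t" for t
    using z unfolding P_def by (intro divide_nonneg_nonneg) (auto simp: power_le_one)
  define \<rho> where "\<rho> = (\<lambda>n. real n / (real n + 1))"
  have \<rho>: "0 \<le> \<rho> n" "\<rho> n < 1" for n by (auto simp: \<rho>_def)
  have \<rho>_lim: "\<rho> \<longlonglongrightarrow> 1"
    unfolding \<rho>_def using LIMSEQ_n_over_Suc_n by (simp add: add.commute)
  have in_ball: "norm (complex_of_real (\<rho> n) * w) < 1" if "norm w \<le> 1" for n w
    using \<rho>[of n] that by (metis (no_types, lifting) abs_of_nonneg le_less_trans mult_left_le norm_mult norm_of_real)
  have approx: "((\<lambda>t. P t * Re (h (of_real (\<rho> n) * cis t))) has_integral 2 * pi * Re (h (of_real (\<rho> n) * z))) {0..2*pi}" for n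
  proof -
    have "(\<lambda>w. h (of_real (\<rho> n) * w)) holomorphic_on cball 0 1"
      using in_ball by (intro holomorphic_on_compose_gen[OF _ hol, unfolded o_def] holomorphic_intros) auto
    from has_integral_Re[OF Poisson_formula_holomorphic[OF this z]]
    show ?thesis by (simp add: P_def)
  qed
  have "compact ((\<lambda>z. Re (h z)) ` cball 0 1)"
    by (intro compact_continuous_image cont) auto
  then obtain B where B: "\<And>w. norm w \<le> 1 \<Longrightarrow> \<bar>Re (h w)\<bar> \<le> B"
    by (force dest!: compact_imp_bounded simp: bounded_iff)
  have lim: "(\<lambda>n. Re (h (of_real (\<rho> n) * w))) \<longlonglongrightarrow> Re (h w)" if "norm w \<le> 1" for w
  proof (rule continuous_on_tendsto_compose[OF cont])
    show "(\<lambda>n. of_real (\<rho> n) * w) \<longlonglongrightarrow> w"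
      using tendsto_mult[OF tendsto_of_real[OF \<rho>_lim] tendsto_const[of w]] by simp
    show "\<forall>\<^sub>F n in sequentially. of_real (\<rho> n) * w \<in> cball 0 1"
      using in_ball[OF that] by (intro always_eventually) (simp add: less_imp_le)
  qed (use that in simp)
  have "((\<lambda>t. P t * Re (h (cis t))) has_integral 2 * pi * Re (h z)) {0..2*pi}"
  proof (rule has_integral_dominated_convergence[OF approx])
    show "(\<lambda>t. P t * B) integrable_on {0..2*pi}"
      by (intro integrable_continuous_real continuous_intros continuous_on_subset[OF contP]) auto
    show "\<forall>t\<in>{0..2*pi}. norm (P t * Re (h (of_real (\<rho> n) * cis t))) \<le> P t * B" for n
      using B[OF less_imp_le[OF in_ball]] P_nonneg by (auto simp: abs_mult intro!: mult_left_mono)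
    show "\<forall>t\<in>{0..2*pi}. (\<lambda>n. P t * Re (h (of_real (\<rho> n) * cis t))) \<longlonglongrightarrow> P t * Re (h (cis t))"
      by (intro ballI tendsto_intros lim) simp
    show "(\<lambda>n. 2 * pi * Re (h (of_real (\<rho> n) * z))) \<longlonglongrightarrow> 2 * pi * Re (h z)"
      using z by (intro tendsto_intros lim) simp
  qed
  moreover have "continuous_on {0..2*pi} (\<lambda>t. Re (h (cis t)))"
    by (rule continuous_on_compose2[OF cont]) (auto intro!: continuous_intros)
  then have contPh: "continuous_on {0..2*pi} (\<lambda>t. P t * Re (h (cis t)))"
    by (intro continuous_on_mult continuous_on_subset[OF contP]) auto
  ultimately have "(LINT t|lebesgue_on {0..2*pi}. P t * Re (h (cis t))) = 2 * pi * Re (h z)"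
    using lebesgue_integral_eq_integral[OF continuous_imp_integrable_real[OF contPh]] by (simp add: integral_unique)
  moreover have "poisson_kernel 0 (z * cis (- t)) = P t" for t
    using z nz[of t] unfolding poisson_kernel_def poisson_const_def P_def
    by (simp add: norm_mult powr_numeral abs_square_less_1 power_le_one)
  ultimately show ?thesis
    unfolding poisson_integral_def F by (simp flip: of_real_mult) (simp)
qed

section \<open>Wirtinger derivatives of real-valued functions\<close>

lemma wirtinger_partials_of_real:
  fixes u :: "complex \<Rightarrow> real"
  assumes f: "\<And>z. norm z < 1 \<Longrightarrow> f z = complex_of_real (u z)"
    and der: "(u has_derivative (\<lambda>d. Re (H * d))) (at z)" and z: "norm z < 1"
  shows "partial_z f z = H / 2" "partial_zbar f z = cnj H / 2"
    "partial_r f z = complex_of_real (Re (H * cis (Arg z)))"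
proof -
  have along: "((\<lambda>t. f (z + c * complex_of_real t)) has_vector_derivative complex_of_real (Re (H * c))) (at 0)" for c
  proof -
    have "((\<lambda>t. z + c * complex_of_real t) has_derivative (\<lambda>t. c * complex_of_real t)) (at 0)"
      by (auto intro!: derivative_eq_intros)
    then have "((\<lambda>t. u (z + c * complex_of_real t)) has_derivative (\<lambda>t. Re (H * (c * complex_of_real t)))) (at 0)"
      by (rule has_derivative_compose) (use der in simp)
    then have "((\<lambda>t. u (z + c * complex_of_real t)) has_vector_derivative Re (H * c)) (at 0)"
      by (simp add: has_vector_derivative_def algebra_simps)
    then have "((\<lambda>t. complex_of_real (u (z + c * complex_of_real t))) has_vector_derivative
        complex_of_real (Re (H * c))) (at 0)"
      by (intro has_vector_derivative_of_real) (simp add: has_real_derivative_iff_has_vector_derivative)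
    then show ?thesis
    proof (rule has_vector_derivative_transform_within_open)
      show "open ((\<lambda>t. z + c * complex_of_real t) -` ball 0 1)"
        by (intro open_vimage continuous_intros) auto
    qed (use f z in auto)
  qed
  have x: "partial_x f z = complex_of_real (Re H)"
    using along[of 1] unfolding partial_x_def by (intro vector_derivative_at) simp
  have y: "partial_y f z = - complex_of_real (Im H)"
    using along[of \<i>] unfolding partial_y_def by (intro vector_derivative_at) simp
  show dz: "partial_z f z = H / 2" and dzbar: "partial_zbar f z = cnj H / 2"
    unfolding partial_z_def partial_zbar_def x y by (auto simp: complex_eq_iff)
  show "partial_r f z = complex_of_real (Re (H * cis (Arg z)))"
    unfolding partial_r_def dz dzbar by (auto simp: complex_eq_iff field_simps)
qed

text \<open>For real-valued functions both Wirtinger derivatives have modulus \<open>\<bar>H\<bar> / 2\<close>, which is at least half of the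
  modulus of the radial derivative. Hence a lower bound for the radial derivative serves for all three
  derivatives, up to the factor \<open>2\<close>.\<close>

lemma wirtinger_partials_ge_radial:
  fixes u :: "complex \<Rightarrow> real"
  assumes f: "\<And>z. norm z < 1 \<Longrightarrow> f z = complex_of_real (u z)"
    and der: "\<And>z. norm z < 1 \<Longrightarrow> (u has_derivative (\<lambda>d. Re (H z * d))) (at z)"
    and g: "g \<in> {partial_r f, partial_z f, partial_zbar f}"
    and r: "0 < r" "r < 1"
  shows "\<bar>Re (H (complex_of_real r * cis t) * cis t)\<bar> \<le> 2 * norm (g (complex_of_real r * cis t))"
proof -
  define z where "z = complex_of_real r * cis t"
  have z: "norm z < 1" using r by (simp add: z_def norm_mult)
  have [simp]: "cis (Arg z) = cis t"
    using r by (subst cis_Arg) (auto simp: z_def sgn_eq norm_mult)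
  have "\<bar>Re (H z * cis t)\<bar> \<le> norm (H z)"
    using abs_Re_le_cmod[of "H z * cis t"] by (simp add: norm_mult)
  moreover note partials = wirtinger_partials_of_real[OF f der[OF z] z]
  moreover have "norm (partial_z f z) = norm (H z) / 2" "norm (partial_zbar f z) = norm (H z) / 2"
    "norm (partial_r f z) = \<bar>Re (H z * cis t)\<bar>"
    by (simp_all add: partials norm_divide del: times_complex.sel)
  ultimately show ?thesis
    using g unfolding z_def[symmetric] by auto
qed

section \<open>Criteria for an infinite Hardy norm\<close>

lemma hardy_norm_infinite_if_means_unbounded:
  assumes "\<And>M. \<exists>r\<in>{0..<1}. ennreal M \<le> integral_mean p r g"
  shows "hardy_norm p g = \<infinity>"
proof -
  have low: "ennreal M \<le> hardy_norm p g" for M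
    using assms[of M] unfolding hardy_norm_def by (blast intro: SUP_upper2)
  show ?thesis
  proof (cases "hardy_norm p g" rule: ennreal_cases)
    case (real x)
    then show ?thesis using low[of "x + 1"] by simp
  qed simp
qed

lemma hardy_norm_infinity_unbounded:
  assumes "\<And>M. \<exists>r\<in>{0..<1}. \<exists>t\<in>{0..2*pi}. M \<le> norm (g (complex_of_real r * cis t))"
  shows "hardy_norm \<infinity> g = \<infinity>"
proof (rule hardy_norm_infinite_if_means_unbounded)
  fix M
  obtain r t where rt: "r \<in> {0..<1}" "t \<in> {0..2*pi}" "M \<le> norm (g (complex_of_real r * cis t))"
    using assms by blast
  then show "\<exists>r\<in>{0..<1}. ennreal M \<le> integral_mean \<infinity> r g"
    unfolding integral_mean_def by (intro bexI[of _ r]) (auto intro!: SUP_upper2 ennreal_leI)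
qed

text \<open>If \<open>\<bar>g\<bar>\<close> is large on a whole circle, then so are all its integral means there, whatever the exponent.\<close>

lemma hardy_norm_unbounded_on_circles:
  assumes p: "0 < p"
    and low: "\<And>M. \<exists>r\<in>{0..<1}. \<forall>t\<in>{0..2*pi}. M \<le> norm (g (complex_of_real r * cis t))"
  shows "hardy_norm p g = \<infinity>"
proof (cases "p = \<infinity>")
  case True
  have "0 \<in> {0..2*pi}" by simp
  then have "hardy_norm \<infinity> g = \<infinity>"
    using low by (intro hardy_norm_infinity_unbounded) blast
  then show ?thesis by (simp add: True)
next
  case False
  then obtain q where q: "p = ereal q" "0 < q" using p by (cases p) auto
  show ?thesis
  proof (rule hardy_norm_infinite_if_means_unbounded)
    fix M :: real
    obtain r where r: "r \<in> {0..<1}" "\<forall>t\<in>{0..2*pi}. max M 1 \<le> norm (g (complex_of_real r * cis t))"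
      using low by blast
    let ?I = "ennreal (1 / (2 * pi)) * (\<integral>\<^sup>+ \<theta>. ennreal (norm (g (complex_of_real r * cis \<theta>)) powr q) \<partial>lebesgue_on {0..2 * pi})"
    have "ennreal (max M 1 powr q) = ennreal (1 / (2 * pi)) * (\<integral>\<^sup>+ \<theta>. ennreal (max M 1 powr q) \<partial>lebesgue_on {0..2 * pi})"
      by (simp add: emeasure_restrict_space flip: ennreal_mult)
    also have "\<dots> \<le> ?I"
      using r q by (intro mult_left_mono nn_integral_mono ennreal_leI powr_mono2)
        (auto simp: space_restrict_space)
    finally have "ennreal (max M 1 powr q) \<le> ?I" .
    then have "ennreal (max M 1) \<le> ennreal_powr ?I (1 / q)"
    proof (cases "?I" rule: ennreal_cases)
      case (real x)
      then have "max M 1 powr q \<le> x" using \<open>ennreal (max M 1 powr q) \<le> ?I\<close> by simp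
      then have "(max M 1 powr q) powr (1 / q) \<le> x powr (1 / q)" using q by (intro powr_mono2) auto
      then have "max M 1 \<le> x powr (1 / q)" using q by (simp add: powr_powr)
      then show ?thesis using real by (simp add: ennreal_powr_def)
    qed (simp add: ennreal_powr_def)
    then have "ennreal M \<le> integral_mean p r g"
      unfolding integral_mean_def q by (auto intro: order_trans[rotated] ennreal_leI)
    then show "\<exists>r\<in>{0..<1}. ennreal M \<le> integral_mean p r g" using r by blast
  qed
qed

text \<open>For \<open>p = 1\<close> it suffices to bound the mean over the upper half circle from below by integrals of
  continuous minorants, which may change sign.\<close>

lemma hardy_norm_1_unbounded:
  assumes "\<And>M. \<exists>r\<in>{0..<1}. \<exists>k I. continuous_on {0..pi} k \<and> (k has_integral I) {0..pi} \<and> M \<le> I \<and>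
      (\<forall>t\<in>{0..pi}. k t \<le> norm (g (complex_of_real r * cis t)))"
  shows "hardy_norm 1 g = \<infinity>"
proof (rule hardy_norm_infinite_if_means_unbounded)
  fix M :: real
  obtain r k I where r: "r \<in> {0..<1}" and k: "continuous_on {0..pi} k" "(k has_integral I) {0..pi}" "2 * pi * M \<le> I"
    "\<And>t. t \<in> {0..pi} \<Longrightarrow> k t \<le> norm (g (complex_of_real r * cis t))"
    using assms[of "2 * pi * M"] by blast
  have int: "integrable (lebesgue_on {0..pi}) k"
    using k(1) by (rule continuous_imp_integrable_real)
  have "I = integral\<^sup>L (lebesgue_on {0..pi}) k"
    using lebesgue_integral_eq_integral[OF int] k(2) by (simp add: integral_unique)
  also have "\<dots> \<le> enn2real (\<integral>\<^sup>+ t. ennreal (k t) \<partial>lebesgue_on {0..pi})"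
    by (simp add: real_lebesgue_integral_def[OF int])
  finally have "ennreal I \<le> ennreal (enn2real (\<integral>\<^sup>+ t. ennreal (k t) \<partial>lebesgue_on {0..pi}))"
    by (rule ennreal_leI)
  also have "\<dots> \<le> (\<integral>\<^sup>+ t. ennreal (k t) \<partial>lebesgue_on {0..pi})"
    by (cases "(\<integral>\<^sup>+ t. ennreal (k t) \<partial>lebesgue_on {0..pi})" rule: ennreal_cases) auto
  also have "\<dots> = (\<integral>\<^sup>+ t. ennreal (k t) * indicator {0..pi} t \<partial>lebesgue)"
    by (simp add: nn_integral_restrict_space)
  also have "\<dots> \<le> (\<integral>\<^sup>+ t. ennreal (norm (g (complex_of_real r * cis t))) * indicator {0..2*pi} t \<partial>lebesgue)"
    using k(4) by (intro nn_integral_mono) (auto simp: indicator_def intro: ennreal_leI)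
  also have "\<dots> = (\<integral>\<^sup>+ t. ennreal (norm (g (complex_of_real r * cis t))) \<partial>lebesgue_on {0..2*pi})"
    by (simp add: nn_integral_restrict_space)
  finally have "ennreal I \<le> (\<integral>\<^sup>+ t. ennreal (norm (g (complex_of_real r * cis t))) \<partial>lebesgue_on {0..2*pi})" .
  then have "ennreal (1 / (2 * pi)) * ennreal I \<le> ennreal (1 / (2 * pi)) * (\<integral>\<^sup>+ t. ennreal (norm (g (complex_of_real r * cis t))) \<partial>lebesgue_on {0..2*pi})"
    by (intro mult_left_mono) auto
  moreover have "ennreal M \<le> ennreal (1 / (2 * pi)) * ennreal I"
  proof -
    have "M \<le> 1 / (2 * pi) * I" using k(3) by (simp add: field_simps)
    then show ?thesis by (subst ennreal_mult'[symmetric]) (auto intro: ennreal_leI)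
  qed
  moreover have "ennreal_powr x 1 = x" for x
    by (cases x rule: ennreal_cases) (auto simp: ennreal_powr_def)
  ultimately have "ennreal M \<le> integral_mean 1 r g"
    by (simp add: integral_mean_def)
  then show "\<exists>r\<in>{0..<1}. ennreal M \<le> integral_mean 1 r g" using r by blast
qed

section \<open>Negative parameter: the constant boundary function\<close>

lemma integral_cis_int:
  fixes k :: int
  shows "(LINT t|lebesgue_on {0..2*pi}. cis (of_int k * t)) = (if k = 0 then 2 * pi else 0)"
proof -
  have cont: "continuous_on {0..2*pi} (\<lambda>t. cis (of_int k * t))"
    by (intro continuous_intros)
  have "((\<lambda>t. cis (of_int k * t)) has_integral (if k = 0 then 2 * pi else 0)) {0..2*pi}"
  proof (cases "k = 0")
    case True
    then show ?thesis using has_integral_const_real[of "1::complex" 0 "2*pi"] by (simp add: scaleR_conv_of_real)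
  next
    case False
    have "((\<lambda>t. cis (of_int k * t)) has_integral
        cis (of_int k * (2*pi)) / (\<i> * of_int k) - cis (of_int k * 0) / (\<i> * of_int k)) {0..2*pi}"
      using False by (intro fundamental_theorem_of_calculus)
        (auto intro!: derivative_eq_intros simp: has_vector_derivative_def scaleR_conv_of_real fun_eq_iff complex_eq_iff)
    moreover have "cis (of_int k * (2*pi)) = 1"
      using cis_multiple_2pi[of "of_int k"] by (simp add: mult_ac)
    ultimately show ?thesis using False by simp
  qed
  then show ?thesis
    using lebesgue_integral_eq_integral[OF continuous_imp_integrable_real[OF cont]]
    by (simp add: integral_unique)
qed

text \<open>All integrals of products of \<open>u\<close> with an integrable function can be computed termwise, since the power
  series converges absolutely and uniformly on the circle. Applied to \<open>cis (m t)\<close> this yields the Fourier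
  coefficients of \<open>u\<close>, and applied to the conjugate of \<open>u\<close> it then yields the mean of \<open>\<bar>u\<bar>\<^sup>2\<close>.\<close>

lemma Parseval_power_series:
  fixes a :: "nat \<Rightarrow> complex"
  assumes u: "\<And>w. norm w < 1 \<Longrightarrow> (\<lambda>n. a n * w ^ n) sums u w" and z: "norm z < 1"
  shows "(\<lambda>n. (norm (a n))\<^sup>2 * ((norm z)\<^sup>2) ^ n) sums
           (1 / (2 * pi) * (LINT t|lebesgue_on {0..2*pi}. (norm (u (z * cis (- t))))\<^sup>2))"
proof -
  define M where "M = lebesgue_on {0..2*pi}"
  define v where "v = (\<lambda>t. u (z * cis (- t)))"
  define e where "e = (\<lambda>n t. a n * z ^ n * cis (- (real n * t)))"
  have e_sums: "(\<lambda>n. e n t) sums v t" for t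
    using u[of "z * cis (- t)"] z
    by (simp add: e_def v_def norm_mult power_mult_distrib Complex.DeMoivre mult_ac)
  obtain x where x: "norm z < x" "x < 1" using z dense by blast
  then have "norm (complex_of_real x) < 1" by (smt (verit) norm_ge_zero norm_of_real)
  then have "summable (\<lambda>n. norm (a n * z ^ n))"
    using x by (intro powser_insidea[of a "complex_of_real x"] sums_summable[OF u]) auto
  then have S: "summable (\<lambda>n. norm (a n) * norm z ^ n)" by (simp add: norm_mult norm_power)
  have norm_e: "norm (e n t) = norm (a n) * norm z ^ n" for n t
    by (simp add: e_def norm_mult norm_power)
  have cont_int: "integrable M k" if "continuous_on {0..2*pi} k" for k :: "real \<Rightarrow> complex"
    using that unfolding M_def by (rule continuous_imp_integrable_real)
  have e_cont: "continuous_on A (e n)" for n A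
    unfolding e_def by (intro continuous_intros)
  have e_meas: "e n \<in> borel_measurable M" for n
    by (rule borel_measurable_integrable[OF cont_int[OF e_cont]])
  have eg: "integrable M (\<lambda>t. e n t * g t)" if "integrable M g" for n g
    by (rule Bochner_Integration.integrable_bound[OF integrable_mult_right[OF integrable_norm[OF that], of "norm (a n) * norm z ^ n"]])
      (use that e_meas in \<open>auto simp: norm_mult norm_e\<close>)
  have eg_sums: "(\<lambda>n. LINT t|M. e n t * g t) sums (LINT t|M. v t * g t)"
    and eg_int: "integrable M (\<lambda>t. v t * g t)" if g: "integrable M g" for g
  proof -
    have AE: "AE t in M. summable (\<lambda>n. norm (e n t * g t))"
      using summable_mult2[OF S] by (intro AE_I2) (simp add: norm_mult norm_e)
    have sm: "summable (\<lambda>n. LINT t|M. norm (e n t * g t))"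
      using summable_mult2[OF S] by (simp add: norm_mult norm_e)
    have lim: "(\<Sum>n. e n t * g t) = v t * g t" for t
      using sums_unique[OF sums_mult2[OF e_sums]] by metis
    show "(\<lambda>n. LINT t|M. e n t * g t) sums (LINT t|M. v t * g t)"
      using sums_integral[OF eg[OF g] AE sm] by (simp only: lim)
    show "integrable M (\<lambda>t. v t * g t)"
      using integrable_suminf[OF eg[OF g] AE sm] by (simp only: lim)
  qed
  have fourier: "(LINT t|M. v t * cis (real m * t)) = 2 * pi * (a m * z ^ m)" for m
  proof -
    have "(\<lambda>n. LINT t|M. e n t * cis (real m * t)) sums (LINT t|M. v t * cis (real m * t))"
      by (intro eg_sums cont_int continuous_intros)
    moreover have "(LINT t|M. e n t * cis (real m * t)) = (if n = m then 2 * pi * (a m * z ^ m) else 0)" for n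
    proof -
      have "(LINT t|M. e n t * cis (real m * t)) = (LINT t|M. (a n * z ^ n) * cis (of_int (int m - int n) * t))"
        by (simp add: e_def mult.assoc cis_mult algebra_simps)
      also have "\<dots> = (a n * z ^ n) * (LINT t|M. cis (of_int (int m - int n) * t))"
        by (rule integral_mult_right_zero)
      finally show ?thesis unfolding M_def integral_cis_int by auto
    qed
    ultimately have "(\<lambda>n. if n = m then 2 * pi * (a n * z ^ n) else 0) sums (LINT t|M. v t * cis (real m * t))"
      by (simp cong: if_cong)
    from sums_unique2[OF this sums_single] show ?thesis by simp
  qed
  have v_int: "integrable M v"
    using eg_int[OF cont_int[of "\<lambda>t. 1"]] by simp
  have cnj: "(LINT t|M. e n t * cnj (v t)) = 2 * pi * ((norm (a n))\<^sup>2 * ((norm z)\<^sup>2) ^ n)" for n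
  proof -
    have "(LINT t|M. e n t * cnj (v t)) = (LINT t|M. (a n * z ^ n) * cnj (v t * cis (real n * t)))"
      by (simp add: e_def cis_cnj mult_ac)
    also have "\<dots> = (a n * z ^ n) * cnj (LINT t|M. v t * cis (real n * t))"
      by (simp only: integral_mult_right_zero Bochner_Integration.integral_cnj)
    also have "\<dots> = 2 * pi * ((a n * z ^ n) * cnj (a n * z ^ n))"
      by (simp add: fourier)
    also have "(a n * z ^ n) * cnj (a n * z ^ n) = (norm (a n))\<^sup>2 * ((norm z)\<^sup>2) ^ n"
      by (subst complex_norm_square[symmetric]) (simp add: norm_mult norm_power power_mult_distrib mult.commute[of n] flip: power_mult)
    finally show ?thesis by simp
  qed
  have "(\<lambda>n. LINT t|M. e n t * cnj (v t)) sums (LINT t|M. v t * cnj (v t))"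
    using v_int by (intro eg_sums) simp
  also have "(\<lambda>t. v t * cnj (v t)) = (\<lambda>t. complex_of_real ((norm (v t))\<^sup>2))"
    by (simp only: complex_norm_square)
  finally have "(\<lambda>n. complex_of_real (2 * pi * ((norm (a n))\<^sup>2 * ((norm z)\<^sup>2) ^ n))) sums
      complex_of_real (LINT t|M. (norm (v t))\<^sup>2)"
    unfolding cnj integral_complex_of_real by simp
  then have "(\<lambda>n. 2 * pi * ((norm (a n))\<^sup>2 * ((norm z)\<^sup>2) ^ n)) sums (LINT t|M. (norm (v t))\<^sup>2)"
    by (simp only: sums_of_real_iff)
  then have "(\<lambda>n. 1 / (2 * pi) * (2 * pi * ((norm (a n))\<^sup>2 * ((norm z)\<^sup>2) ^ n))) sums
      (1 / (2 * pi) * (LINT t|M. (norm (v t))\<^sup>2))"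
    by (rule sums_mult)
  then show ?thesis by (simp add: M_def v_def)
qed

text \<open>The square of the coefficient of \<open>w^n\<close> in the binomial series of \<open>(1 - w) powr (-s)\<close>.\<close>

definition binomial_coeff_sq :: "real \<Rightarrow> nat \<Rightarrow> real" where
  "binomial_coeff_sq s n = (pochhammer s n / fact n)\<^sup>2"

lemma binomial_coeff_sq_bounds:
  assumes "0 < s" "s \<le> 1"
  shows "0 \<le> binomial_coeff_sq s n" "binomial_coeff_sq s n \<le> 1"
proof -
  have "0 \<le> pochhammer s n \<and> pochhammer s n \<le> fact n"
  proof (induction n)
    case (Suc n)
    then have "pochhammer s n * (s + real n) \<le> fact n * (1 + real n)"
      using assms by (intro mult_mono) auto
    then show ?case using Suc assms by (simp add: pochhammer_Suc algebra_simps)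
  qed simp
  then have "pochhammer s n / fact n \<le> 1" and "0 \<le> pochhammer s n / fact n" by auto
  then show "0 \<le> binomial_coeff_sq s n" "binomial_coeff_sq s n \<le> 1"
    by (auto simp: binomial_coeff_sq_def power_le_one)
qed

text \<open>The left-hand side is the coefficient of \<open>x^n\<close> in \<open>(1 - x) G' - (2 s - 1) G\<close>, where \<open>G\<close> is the power
  series with coefficients \<open>binomial_coeff_sq s n\<close>. Its nonnegativity is what makes the radial derivative blow up.\<close>

lemma binomial_coeff_sq_Suc:
  "real (Suc n) * binomial_coeff_sq s (Suc n) - real n * binomial_coeff_sq s n - (2 * s - 1) * binomial_coeff_sq s n
     = binomial_coeff_sq s n * (s - 1)\<^sup>2 / (real n + 1)"
proof -
  define q where "q = ((s + real n) / (real n + 1))\<^sup>2"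
  have step: "binomial_coeff_sq s (Suc n) = binomial_coeff_sq s n * q"
    by (simp add: binomial_coeff_sq_def q_def pochhammer_Suc power_divide power_mult_distrib add.commute)
  have "(real n + 1) * q - real n - (2 * s - 1) = (s - 1)\<^sup>2 / (real n + 1)"
    by (simp add: q_def divide_simps power2_eq_square) (simp add: algebra_simps)
  then have "binomial_coeff_sq s n * (s - 1)\<^sup>2 / (real n + 1)
      = binomial_coeff_sq s n * ((real n + 1) * q - real n - (2 * s - 1))"
    by simp
  then show ?thesis unfolding step by (simp add: algebra_simps)
qed

text \<open>The product rule gives the derivative \<open>(1 - x) powr (2 s - 2) * ((1 - x) G' - (2 s - 1) G)\<close>. The second
  factor is a power series with nonnegative coefficients, hence at least its constant term \<open>(s - 1)\<^sup>2\<close>.\<close>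

lemma radial_profile_derivative:
  fixes s x :: real
  assumes s: "0 < s" "s \<le> 1" and x: "0 \<le> x" "x < 1"
  shows "\<exists>d. ((\<lambda>x. (1 - x) powr (2 * s - 1) * (\<Sum>n. binomial_coeff_sq s n * x ^ n)) has_real_derivative d) (at x) \<and>
     (1 - x) powr (2 * s - 2) * (s - 1)\<^sup>2 \<le> d"
proof -
  define b where "b = binomial_coeff_sq s"
  have b: "0 \<le> b n" "b n \<le> 1" for n
    unfolding b_def using binomial_coeff_sq_bounds[OF s] by auto
  have sm: "summable (\<lambda>n. b n * y ^ n)" if "norm y < 1" for y :: real
    by (rule summable_comparison_test'[of "\<lambda>n. \<bar>y\<bar> ^ n" 0])
      (use b that in \<open>auto simp: abs_mult power_abs intro!: mult_left_le_one_le\<close>)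
  define G where "G = (\<lambda>x. \<Sum>n. b n * x ^ n)"
  define G' where "G' = (\<Sum>n. diffs b n * x ^ n)"
  have G': "(G has_real_derivative G') (at x)"
    unfolding G_def G'_def using x by (intro termdiffs_strong'[OF sm]) auto
  have sums_d: "(\<lambda>n. diffs b n * x ^ n) sums G'"
    unfolding G'_def using x by (intro summable_sums termdiff_converges[OF _ sm]) auto
  have sums_xd: "(\<lambda>n. real n * b n * x ^ n) sums (x * G')"
  proof -
    have "(\<lambda>n. real (Suc n) * b (Suc n) * x ^ Suc n) sums (x * G')"
      using sums_mult[OF sums_d, of x] by (simp add: diffs_def mult_ac)
    then show ?thesis by (subst (asm) sums_Suc_iff) simp
  qed
  have "(\<lambda>n. diffs b n * x ^ n - real n * b n * x ^ n - (2 * s - 1) * (b n * x ^ n)) sums (G' - x * G' - (2 * s - 1) * G x)"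
    unfolding G_def using x by (intro sums_diff sums_d sums_xd sums_mult summable_sums sm) auto
  also have "(\<lambda>n. diffs b n * x ^ n - real n * b n * x ^ n - (2 * s - 1) * (b n * x ^ n)) = (\<lambda>n. b n * (s - 1)\<^sup>2 / (real n + 1) * x ^ n)"
    unfolding b_def binomial_coeff_sq_Suc[symmetric] diffs_def by (simp add: algebra_simps)
  finally have Q: "(\<lambda>n. b n * (s - 1)\<^sup>2 / (real n + 1) * x ^ n) sums (G' - x * G' - (2 * s - 1) * G x)" .
  have "(\<Sum>n<1. b n * (s - 1)\<^sup>2 / (real n + 1) * x ^ n) \<le> (\<Sum>n. b n * (s - 1)\<^sup>2 / (real n + 1) * x ^ n)"
    using b x by (intro sum_le_suminf sums_summable[OF Q]) auto
  then have low: "(s - 1)\<^sup>2 \<le> G' - x * G' - (2 * s - 1) * G x"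
    using sums_unique[OF Q] by (simp add: b_def binomial_coeff_sq_def)
  have der: "((\<lambda>x. (1 - x) powr (2 * s - 1) * G x) has_real_derivative
      (1 - x) powr (2 * s - 1) * G' - (2 * s - 1) * (1 - x) powr (2 * s - 2) * G x) (at x)"
    using x by (auto intro!: derivative_eq_intros G' simp: algebra_simps)
  have "(1 - x) powr (2 * s - 1) = (1 - x) powr (2 * s - 2) * (1 - x)"
    using x powr_add[of "1 - x" "2 * s - 2" 1] by simp
  then have factor: "(1 - x) powr (2 * s - 1) * G' - (2 * s - 1) * (1 - x) powr (2 * s - 2) * G x =
      (1 - x) powr (2 * s - 2) * (G' - x * G' - (2 * s - 1) * G x)"
    by (simp only:) (simp add: algebra_simps)
  have "(1 - x) powr (2 * s - 2) * (s - 1)\<^sup>2 \<le> (1 - x) powr (2 * s - 2) * (G' - x * G' - (2 * s - 1) * G x)"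
    using low by (intro mult_left_mono) auto
  with der[unfolded factor] show ?thesis unfolding G_def b_def by (intro exI conjI)
qed

text \<open>The radius is kept away from \<open>0\<close> because the radial derivative of a function of \<open>\<bar>z\<bar>\<^sup>2\<close> carries a factor \<open>r\<close>.\<close>

lemma powr_neg_unbounded_below_1:
  fixes a K :: real
  assumes "a < 0" "0 < K"
  shows "\<exists>r. 1/2 \<le> r \<and> r < 1 \<and> M \<le> K * (1 - r\<^sup>2) powr a"
proof -
  define X where "X = max (M / K) 1"
  define y where "y = min (1/2) (X powr (1 / a))"
  have X: "0 < X" "M \<le> K * X" using assms by (auto simp: X_def field_simps max_def)
  then have y: "0 < y" "y \<le> 1/2" "y \<le> X powr (1 / a)" by (auto simp: y_def)
  have "X = (X powr (1 / a)) powr a" using X assms by (simp add: powr_powr)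
  also have "\<dots> \<le> y powr a" using y assms by (intro powr_mono2') auto
  finally have "M \<le> K * y powr a" using X assms by (meson mult_left_mono order_trans less_imp_le)
  moreover have "1/2 \<le> sqrt (1 - y)" using y by (intro real_le_rsqrt) (auto simp: power2_eq_square)
  ultimately show ?thesis using y by (intro exI[of _ "sqrt (1 - y)"]) auto
qed

text \<open>The kernel \<open>1 / \<bar>1 - w\<bar> powr (\<alpha> + 2)\<close> is the squared modulus of \<open>(1 - w) powr (-s)\<close>, so its mean over a circle
  is given by Parseval's formula.\<close>

lemma poisson_integral_one:
  fixes z :: complex and \<alpha> :: real
  assumes z: "norm z < 1"
  defines "s \<equiv> 1 + \<alpha> / 2"
  shows "poisson_integral \<alpha> (\<lambda>_. 1) z = complex_of_real
      (poisson_const \<alpha> * ((1 - (norm z)\<^sup>2) powr (\<alpha> + 1) * (\<Sum>n. binomial_coeff_sq s n * ((norm z)\<^sup>2) ^ n)))"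
proof -
  define u where "u = (\<lambda>w::complex. (1 - w) powr (- complex_of_real s))"
  have "(\<lambda>n. complex_of_real (pochhammer s n / fact n) * w ^ n) sums u w" if "norm w < 1" for w
  proof -
    have "(- complex_of_real s gchoose n) * (- w) ^ n = complex_of_real (pochhammer s n / fact n) * w ^ n" for n
    proof -
      have "(- complex_of_real s gchoose n) * (- w) ^ n
          = ((-1) ^ n * (-1) ^ n) * (complex_of_real (pochhammer s n / fact n) * w ^ n)"
        unfolding gbinomial_pochhammer power_minus[of w n] by (simp add: pochhammer_of_real)
      also have "(-1) ^ n * (-1) ^ n = (1 :: complex)"
        by (simp flip: power_add)
      finally show ?thesis by simp
    qed
    then show ?thesis using gen_binomial_complex[of "- w" "- complex_of_real s"] that
      by (simp add: u_def)
  qed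
  from Parseval_power_series[OF this z]
  have "(\<lambda>n. binomial_coeff_sq s n * ((norm z)\<^sup>2) ^ n) sums
      (1 / (2 * pi) * (LINT t|lebesgue_on {0..2*pi}. (norm (u (z * cis (- t))))\<^sup>2))"
    by (simp add: binomial_coeff_sq_def norm_divide power_divide flip: of_real_divide del: of_real_divide)
  moreover have "(norm (u (z * cis (- t))))\<^sup>2 = 1 / norm (1 - z * cis (- t)) powr (\<alpha> + 2)" for t
  proof -
    have "norm (u (z * cis (- t))) = norm (1 - z * cis (- t)) powr (- s)"
      unfolding u_def by (subst norm_powr_real_powr') auto
    then show ?thesis
      by (simp add: power2_eq_square s_def add.commute flip: powr_add powr_minus_divide)
  qed
  ultimately have *: "(\<lambda>n. binomial_coeff_sq s n * ((norm z)\<^sup>2) ^ n) sums (1 / (2 * pi) * (LINT t|lebesgue_on {0..2*pi}. 1 / norm (1 - z * cis (- t)) powr (\<alpha> + 2)))"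
    by simp
  have "poisson_integral \<alpha> (\<lambda>_. 1) z = complex_of_real (1 / (2 * pi) *
      (LINT t|lebesgue_on {0..2*pi}. poisson_const \<alpha> * (1 - (norm z)\<^sup>2) powr (\<alpha> + 1) * (1 / norm (1 - z * cis (- t)) powr (\<alpha> + 2))))"
    unfolding poisson_integral_def poisson_kernel_def
    by (simp add: norm_mult del: integral_complex_of_real flip: integral_complex_of_real)
  also have "\<dots> = complex_of_real (poisson_const \<alpha> * (1 - (norm z)\<^sup>2) powr (\<alpha> + 1) *
     (1 / (2 * pi) * (LINT t|lebesgue_on {0..2*pi}. 1 / norm (1 - z * cis (- t)) powr (\<alpha> + 2))))"
    by (subst integral_mult_right_zero) simp
  finally show ?thesis
    unfolding sums_unique[OF *, symmetric] by (simp only: mult.assoc)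
qed

lemma poisson_const_pos: "-1 < \<alpha> \<Longrightarrow> 0 < poisson_const \<alpha>"
  unfolding poisson_const_def
  by (intro divide_pos_pos zero_less_power Gamma_real_pos) auto

text \<open>With \<open>2 s - 2 = \<alpha> < 0\<close> the lower bound for the derivative of the radial profile is unbounded as the
  radius tends to \<open>1\<close>.\<close>

lemma hardy_norm_poisson_integral_one:
  assumes \<alpha>: "-1 < \<alpha>" "\<alpha> < 0" and p: "0 < p"
    and g: "g \<in> {partial_r (poisson_integral \<alpha> (\<lambda>_. 1)), partial_z (poisson_integral \<alpha> (\<lambda>_. 1)),
        partial_zbar (poisson_integral \<alpha> (\<lambda>_. 1))}"
  shows "hardy_norm p g = \<infinity>"
proof -
  define s where "s = 1 + \<alpha> / 2"
  have s: "0 < s" "s \<le> 1" "2 * s - 1 = \<alpha> + 1" "2 * s - 2 = \<alpha>" "(s - 1)\<^sup>2 = \<alpha>\<^sup>2 / 4"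
    using \<alpha> by (auto simp: s_def power_divide)
  define C where "C = poisson_const \<alpha>"
  have C: "0 < C" unfolding C_def using \<alpha> by (intro poisson_const_pos)
  define \<phi> where "\<phi> = (\<lambda>x. (1 - x) powr (\<alpha> + 1) * (\<Sum>n. binomial_coeff_sq s n * x ^ n))"
  define \<phi>' where "\<phi>' = (\<lambda>x. SOME d. (\<phi> has_real_derivative d) (at x) \<and> (1 - x) powr \<alpha> * (\<alpha>\<^sup>2 / 4) \<le> d)"
  have "(\<phi> has_real_derivative \<phi>' x) (at x) \<and> (1 - x) powr \<alpha> * (\<alpha>\<^sup>2 / 4) \<le> \<phi>' x"
    if "0 \<le> x" "x < 1" for x
    unfolding \<phi>'_def
    by (rule someI_ex) (use radial_profile_derivative[OF s(1,2) that] in \<open>simp only: s \<phi>_def\<close>)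
  then have \<phi>': "\<And>x. 0 \<le> x \<Longrightarrow> x < 1 \<Longrightarrow> (\<phi> has_real_derivative \<phi>' x) (at x)"
    and low: "\<And>x. 0 \<le> x \<Longrightarrow> x < 1 \<Longrightarrow> (1 - x) powr \<alpha> * (\<alpha>\<^sup>2 / 4) \<le> \<phi>' x"
    by blast+
  define H where "H = (\<lambda>z. complex_of_real (2 * C * \<phi>' ((norm z)\<^sup>2)) * cnj z)"
  have f: "poisson_integral \<alpha> (\<lambda>_. 1) z = complex_of_real (C * \<phi> ((norm z)\<^sup>2))" if "norm z < 1" for z
    using poisson_integral_one[OF that] by (simp add: C_def \<phi>_def s_def)
  have der: "((\<lambda>z. C * \<phi> ((norm z)\<^sup>2)) has_derivative (\<lambda>d. Re (H z * d))) (at z)" if "norm z < 1" for z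
  proof -
    have "((\<lambda>z::complex. (norm z)\<^sup>2) has_derivative (\<lambda>d. 2 * (z \<bullet> d))) (at z)"
      unfolding power2_norm_eq_inner by (auto intro!: derivative_eq_intros simp: inner_commute)
    moreover have "(\<phi> has_derivative (*) (\<phi>' ((norm z)\<^sup>2))) (at ((norm z)\<^sup>2))"
      using \<phi>'[of "(norm z)\<^sup>2"] that by (simp add: has_field_derivative_def abs_square_less_1)
    ultimately have "((\<lambda>z. \<phi> ((norm z)\<^sup>2)) has_derivative (\<lambda>d. \<phi>' ((norm z)\<^sup>2) * (2 * (z \<bullet> d)))) (at z)"
      by (rule has_derivative_compose)
    then have "((\<lambda>z. C * \<phi> ((norm z)\<^sup>2)) has_derivative (\<lambda>d. C * (\<phi>' ((norm z)\<^sup>2) * (2 * (z \<bullet> d))))) (at z)"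
      by (rule has_derivative_mult_right)
    moreover have "C * (\<phi>' ((norm z)\<^sup>2) * (2 * (z \<bullet> d))) = Re (H z * d)" for d
      by (simp add: H_def inner_complex_def algebra_simps)
    ultimately show ?thesis by simp
  qed
  show ?thesis
  proof (rule hardy_norm_unbounded_on_circles[OF p])
    fix M :: real
    \<comment> \<open>The gradient has modulus \<open>2 C r \<phi>'(r\<^sup>2)\<close>; half of it, together with \<open>r \<ge> 1/2\<close> and the factor
      \<open>\<alpha>\<^sup>2 / 4\<close> of the bound on \<open>\<phi>'\<close>, leaves the constant \<open>C \<alpha>\<^sup>2 / 8\<close>.\<close>
    obtain r where r: "1/2 \<le> r" "r < 1" "M \<le> C * \<alpha>\<^sup>2 / 8 * (1 - r\<^sup>2) powr \<alpha>"
      using powr_neg_unbounded_below_1[of \<alpha> "C * \<alpha>\<^sup>2 / 8" M] C \<alpha> by auto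
    have r2: "0 \<le> r\<^sup>2" "r\<^sup>2 < 1" using r by (auto simp: abs_square_less_1)
    have "M \<le> norm (g (complex_of_real r * cis t))" for t
    proof -
      have "H (complex_of_real r * cis t) * cis t = complex_of_real (2 * C * \<phi>' (r\<^sup>2) * r)"
        using r by (simp add: H_def norm_mult cis_cnj cis_mult mult.assoc)
      then have "2 * C * \<phi>' (r\<^sup>2) * r \<le> 2 * norm (g (complex_of_real r * cis t))"
        using wirtinger_partials_ge_radial[OF f der g, of r t] r by simp
      moreover have "C * ((1 - r\<^sup>2) powr \<alpha> * (\<alpha>\<^sup>2 / 4)) * (1/2) \<le> C * \<phi>' (r\<^sup>2) * r"
        using low[OF r2] C r by (intro mult_mono mult_left_mono) (auto intro!: mult_nonneg_nonneg order_trans[OF _ low[OF r2]])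
      ultimately show ?thesis using r(3) by (simp add: algebra_simps)
    qed
    then show "\<exists>r\<in>{0..<1}. \<forall>t\<in>{0..2*pi}. M \<le> norm (g (complex_of_real r * cis t))"
      using r by (intro bexI[of _ r]) auto
  qed
qed

lemma abs_continuous_circle_const: "abs_continuous_circle (\<lambda>_. c)"
  unfolding abs_continuous_circle_def abs_continuous_on_interval_def by (simp add: exI[of _ 1])

lemma in_Lp_circle_deriv_const: "in_Lp_circle p (circle_deriv (\<lambda>_. c))"
proof -
  have "circle_deriv (\<lambda>_. c) = (\<lambda>_. 0)"
    by (simp add: circle_deriv_def fun_eq_iff)
  then show ?thesis by (auto simp: in_Lp_circle_def)
qed

section \<open>Harmonic functions smooth up to the boundary except at one point\<close>

text \<open>Along the circle, \<open>t \<mapsto> Re (h (cis t))\<close> has derivative \<open>- Im (z H(z))\<close> at \<open>z = cis t\<close>. The exceptional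
  point \<open>1\<close> corresponds to the two endpoints of the parameter interval.\<close>

lemma harmonic_boundary_regularity:
  fixes h H :: "complex \<Rightarrow> complex"
  assumes der: "\<And>z. norm z \<le> 1 \<Longrightarrow> z \<noteq> 1 \<Longrightarrow> (h has_field_derivative H z) (at z)"
    and cont: "continuous_on (cball 0 1) (\<lambda>z. Re (h z))"
    and above: "\<And>z. norm z = 1 \<Longrightarrow> z \<noteq> 1 \<Longrightarrow> Im (z * H z) \<le> B"
  defines "F \<equiv> \<lambda>z. complex_of_real (Re (h z))"
  shows "abs_continuous_circle F" and "in_Lp_circle 1 (circle_deriv F)"
    and "(\<And>z. norm z = 1 \<Longrightarrow> z \<noteq> 1 \<Longrightarrow> - B \<le> Im (z * H z)) \<Longrightarrow> in_Lp_circle \<infinity> (circle_deriv F)"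
proof -
  have ne1: "cis t \<noteq> 1" if "t \<in> {0<..<2*pi}" for t
  proof
    assume "cis t = 1"
    then have "cos t = 1" by (simp add: complex_eq_iff)
    then obtain n :: int where "t = of_int n * 2 * pi" by (auto simp: cos_one_2pi_int)
    with that have "0 < of_int n * (2 * pi)" "of_int n * (2 * pi) < 1 * (2 * pi)" by auto
    then have "0 < (of_int n :: real)" "(of_int n :: real) < 1"
      by (auto simp: zero_less_mult_iff mult_less_cancel_right)
    then show False by (simp only: of_int_0_less_iff of_int_less_1_iff)
  qed
  have contF: "continuous_on {0..2*pi} (\<lambda>t. Re (h (cis t)))"
    by (rule continuous_on_compose2[OF cont]) (auto intro!: continuous_intros)
  have derF: "((\<lambda>t. Re (h (cis t))) has_real_derivative - Im (cis t * H (cis t))) (at t)"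
    if "t \<in> {0<..<2*pi}" for t
  proof -
    have "(cis has_vector_derivative \<i> * cis t) (at t)"
      by (auto intro!: derivative_eq_intros simp: has_vector_derivative_def scaleR_conv_of_real)
    from field_vector_diff_chain_at[OF this der[of "cis t"]] ne1[OF that]
    have "((\<lambda>t. h (cis t)) has_vector_derivative \<i> * cis t * H (cis t)) (at t)"
      by (simp add: o_def)
    from bounded_linear.has_vector_derivative[OF bounded_linear_Re this] show ?thesis
      by (simp add: has_real_derivative_iff_has_vector_derivative algebra_simps)
  qed
  have L: "- B \<le> - Im (cis t * H (cis t))" if "t \<in> {0<..<2*pi}" for t
    using above[of "cis t"] ne1[OF that] by (simp del: times_complex.sel)
  have Fcis: "F (cis t) = complex_of_real (Re (h (cis t)))" for t by (simp add: F_def)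
  note AC = absolutely_continuous_if_derivative_bounded_below[of F, OF Fcis contF derF L]
  show "abs_continuous_circle F" by (rule AC(1))
  show "in_Lp_circle 1 (circle_deriv F)" by (rule AC(2))
  assume below: "\<And>z. norm z = 1 \<Longrightarrow> z \<noteq> 1 \<Longrightarrow> - B \<le> Im (z * H z)"
  have U: "- Im (cis t * H (cis t)) \<le> B" if "t \<in> {0<..<2*pi}" for t
    using below[of "cis t"] ne1[OF that] by (simp del: times_complex.sel)
  show "in_Lp_circle \<infinity> (circle_deriv F)"
    by (rule AC(3)) (assumption | rule U)+
qed

lemma harmonic_wirtinger_ge_radial:
  fixes h H :: "complex \<Rightarrow> complex"
  assumes der: "\<And>z. norm z < 1 \<Longrightarrow> (h has_field_derivative H z) (at z)"
    and cont: "continuous_on (cball 0 1) (\<lambda>z. Re (h z))"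
  defines "f \<equiv> poisson_integral 0 (\<lambda>z. complex_of_real (Re (h z)))"
  assumes g: "g \<in> {partial_r f, partial_z f, partial_zbar f}" and r: "0 < r" "r < 1"
  shows "\<bar>Re (H (complex_of_real r * cis t) * cis t)\<bar> \<le> 2 * norm (g (complex_of_real r * cis t))"
proof (rule wirtinger_partials_ge_radial[OF _ _ g r])
  have "h holomorphic_on ball 0 1"
    using der by (intro holomorphic_onI) (auto simp: field_differentiable_def intro: has_field_derivative_at_within)
  then show "f z = complex_of_real (Re (h z))" if "norm z < 1" for z
    unfolding f_def using that by (intro poisson_integral_0_Re_holomorphic cont refl)
  show "((\<lambda>z. Re (h z)) has_derivative (\<lambda>d. Re (H z * d))) (at z)" if "norm z < 1" for z
    using der[OF that] unfolding has_field_derivative_def by (rule has_derivative_Re)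
qed

text \<open>Along the circle \<open>\<bar>z\<bar> = r\<close> the function \<open>Im h\<close> has the derivative \<open>Re (z H(z))\<close>, which is \<open>r\<close> times the
  radial derivative of \<open>Re h\<close>. So the mean of \<open>\<bar>\<partial>\<^sub>r (Re h)\<bar>\<close> controls the variation of \<open>Im h\<close> from \<open>r\<close> to \<open>-r\<close>.\<close>

lemma hardy_norm_1_conjugate_unbounded:
  fixes h H :: "complex \<Rightarrow> complex"
  assumes der: "\<And>z. norm z < 1 \<Longrightarrow> (h has_field_derivative H z) (at z)"
    and cont: "continuous_on (cball 0 1) (\<lambda>z. Re (h z))"
    and unbdd: "\<And>M. \<exists>r\<in>{0<..<1}. M \<le> Im (h (- complex_of_real r)) - Im (h (complex_of_real r))"
  defines "f \<equiv> poisson_integral 0 (\<lambda>z. complex_of_real (Re (h z)))"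
  assumes g: "g \<in> {partial_r f, partial_z f, partial_zbar f}"
  shows "hardy_norm 1 g = \<infinity>"
proof (rule hardy_norm_1_unbounded)
  fix M :: real
  obtain r where r: "0 < r" "r < 1" and M: "2 * M \<le> Im (h (- complex_of_real r)) - Im (h (complex_of_real r))"
    using unbdd[of "2 * M"] by auto
  let ?z = "\<lambda>t. complex_of_real r * cis t"
  define k where "k = (\<lambda>t. Re (?z t * H (?z t)) / 2)"
  have z: "norm (?z t) < 1" for t using r by (simp add: norm_mult)
  have hol: "h holomorphic_on ball 0 1"
    using der by (intro holomorphic_onI) (auto simp: field_differentiable_def intro: has_field_derivative_at_within)
  then have "continuous_on (ball 0 1) (deriv h)"
    by (intro holomorphic_on_imp_continuous_on holomorphic_deriv) auto
  then have "continuous_on (ball 0 1) H"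
    by (rule continuous_on_eq) (use der in \<open>auto intro: DERIV_imp_deriv\<close>)
  then have "continuous_on {0..pi} (\<lambda>t. H (?z t))"
    by (rule continuous_on_compose2) (use z in \<open>auto intro!: continuous_intros\<close>)
  then have "continuous_on {0..pi} k"
    unfolding k_def by (intro continuous_intros) auto
  moreover have "(k has_integral (Im (h (?z pi)) / 2 - Im (h (?z 0)) / 2)) {0..pi}"
  proof (rule fundamental_theorem_of_calculus)
    fix t
    have "(?z has_vector_derivative \<i> * ?z t) (at t)"
      by (auto intro!: derivative_eq_intros simp: has_vector_derivative_def scaleR_conv_of_real)
    from field_vector_diff_chain_at[OF this der[OF z]]
    have "((\<lambda>t. h (?z t)) has_vector_derivative \<i> * ?z t * H (?z t)) (at t)"
      by (simp add: o_def)
    from bounded_linear.has_vector_derivative[OF bounded_linear_Im this]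
    have "((\<lambda>t. Im (h (?z t))) has_real_derivative Re (?z t * H (?z t))) (at t)"
      by (simp add: has_real_derivative_iff_has_vector_derivative algebra_simps)
    from DERIV_cdivide[OF this, of 2]
    show "((\<lambda>t. Im (h (?z t)) / 2) has_vector_derivative k t) (at t within {0..pi})"
      unfolding k_def has_real_derivative_iff_has_vector_derivative
      by (rule has_vector_derivative_at_within)
  qed simp
  moreover have "M \<le> Im (h (?z pi)) / 2 - Im (h (?z 0)) / 2"
    using M by simp
  moreover have "k t \<le> norm (g (?z t))" for t
  proof -
    have "2 * k t = r * Re (H (?z t) * cis t)"
    proof -
      have "?z t * H (?z t) = complex_of_real r * (H (?z t) * cis t)" by (simp add: mult_ac)
      moreover have "Re (complex_of_real r * w) = r * Re w" for w by simp
      ultimately have "Re (?z t * H (?z t)) = r * Re (H (?z t) * cis t)" by (simp only:)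
      then show ?thesis unfolding k_def by linarith
    qed
    also have "\<dots> \<le> r * \<bar>Re (H (?z t) * cis t)\<bar>"
      using r by (intro mult_left_mono) auto
    also have "\<dots> \<le> 1 * \<bar>Re (H (?z t) * cis t)\<bar>"
      using r by (intro mult_right_mono) auto
    also have "\<dots> \<le> 2 * norm (g (?z t))"
      using harmonic_wirtinger_ge_radial[OF der cont g[unfolded f_def] r] by simp
    finally show ?thesis by simp
  qed
  ultimately show "\<exists>r\<in>{0..<1}. \<exists>k I. continuous_on {0..pi} k \<and> (k has_integral I) {0..pi} \<and> M \<le> I \<and>
      (\<forall>t\<in>{0..pi}. k t \<le> norm (g (complex_of_real r * cis t)))"
    using r by (intro bexI[of _ r] exI[of _ k] exI[of _ "Im (h (?z pi)) / 2 - Im (h (?z 0)) / 2"]) auto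
qed

section \<open>The two harmonic examples\<close>

lemma one_minus_cball:
  fixes z :: complex
  assumes "norm z \<le> 1" "z \<noteq> 1"
  shows "0 < Re (1 - z)" "norm (1 - z) \<le> 2" "1 - z \<notin> \<real>\<^sub>\<le>\<^sub>0"
proof -
  have "Re z < 1"
  proof (rule ccontr)
    assume "\<not> Re z < 1"
    then have "Re z = norm z" "norm z = 1" using complex_Re_le_cmod[of z] assms(1) by auto
    then have "Im z = 0" using cmod_power2[of z] by simp
    then show False using \<open>Re z = norm z\<close> \<open>norm z = 1\<close> assms(2) by (simp add: complex_eq_iff)
  qed
  then show "0 < Re (1 - z)" by simp
  then show "1 - z \<notin> \<real>\<^sub>\<le>\<^sub>0" by (auto simp: complex_nonpos_Reals_iff)
  show "norm (1 - z) \<le> 2" using norm_triangle_ineq4[of 1 z] assms(1) by simp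
qed

lemma continuous_on_cball_except_1:
  fixes k :: "complex \<Rightarrow> 'a::real_normed_vector"
  assumes "\<And>z. norm z \<le> 1 \<Longrightarrow> z \<noteq> 1 \<Longrightarrow> isCont k z"
    and "(k \<longlongrightarrow> k 1) (at 1)"
  shows "continuous_on (cball 0 1) k"
  unfolding continuous_on_eq_continuous_within
proof
  fix z :: complex assume "z \<in> cball 0 1"
  then show "continuous (at z within cball 0 1) k"
    using assms by (cases "z = 1") (auto simp: isCont_def intro: continuous_at_imp_continuous_at_within)
qed

text \<open>The logarithm is estimated by \<open>\<bar>ln x\<bar> = 2 ln (1 / sqrt x) \<le> 2 / sqrt x\<close>, so that \<open>w Log w\<close> vanishes at \<open>0\<close>.\<close>

lemma norm_mult_Ln_le:
  assumes "w \<noteq> 0" "norm w \<le> 1"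
  shows "norm (w * Ln w) \<le> 2 * sqrt (norm w) + pi * norm w"
proof -
  let ?x = "norm w"
  have x: "0 < ?x" using assms by simp
  have "\<bar>ln ?x\<bar> = 2 * ln (1 / sqrt ?x)"
    using x assms(2) by (simp add: ln_div ln_sqrt)
  also have "\<dots> \<le> 2 * (1 / sqrt ?x)"
    using x ln_bound[of "1 / sqrt ?x"] by simp
  finally have "?x * \<bar>ln ?x\<bar> \<le> ?x * (2 * (1 / sqrt ?x))"
    using x by (intro mult_left_mono) auto
  also have "\<dots> = 2 * sqrt ?x"
    using x by (simp add: field_simps)
  finally have "?x * \<bar>ln ?x\<bar> \<le> 2 * sqrt ?x" .
  moreover have "\<bar>Im (Ln w)\<bar> \<le> pi"
    using mpi_less_Im_Ln[OF assms(1)] Im_Ln_le_pi[OF assms(1)] by linarith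
  then have "?x * norm (Ln w) \<le> ?x * (\<bar>ln ?x\<bar> + pi)"
    using cmod_le[of "Ln w"] assms(1) x by (intro mult_left_mono) auto
  ultimately show ?thesis by (simp add: norm_mult algebra_simps)
qed

lemma tendsto_mult_Ln: "((\<lambda>z. (1 - z) * Ln (1 - z)) \<longlongrightarrow> 0) (at 1)"
proof (rule Lim_null_comparison)
  show "\<forall>\<^sub>F z in at 1. norm ((1 - z) * Ln (1 - z)) \<le> 2 * sqrt (norm (1 - z)) + pi * norm (1 - z)"
    unfolding eventually_at
    by (intro exI[of _ 1] conjI ballI impI norm_mult_Ln_le) (auto simp: dist_norm norm_minus_commute)
  have "((\<lambda>z::complex. 2 * sqrt (norm (1 - z)) + pi * norm (1 - z)) \<longlongrightarrow> 2 * sqrt (norm (1 - 1::complex)) + pi * norm (1 - 1::complex)) (at 1)"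
    by (intro tendsto_intros)
  then show "((\<lambda>z::complex. 2 * sqrt (norm (1 - z)) + pi * norm (1 - z)) \<longlongrightarrow> 0) (at 1)" by simp
qed

text \<open>The derivative of this function inherits the singularity of the logarithm at \<open>z = 1\<close>, of which the real part
  is unbounded and the imaginary part bounded; the function itself is continuous on the closed disc.\<close>

abbreviation xlogx :: "complex \<Rightarrow> complex" where "xlogx z \<equiv> (1 - z) * Ln (1 - z)"
abbreviation xlogx_deriv :: "complex \<Rightarrow> complex" where "xlogx_deriv z \<equiv> - Ln (1 - z) - 1"

lemma Ln_one_minus_has_derivative:
  assumes "norm z \<le> 1" "z \<noteq> 1"
  shows "((\<lambda>z. Ln (1 - z)) has_field_derivative - inverse (1 - z)) (at z)"
proof -
  have "((\<lambda>z. 1 - z) has_field_derivative - 1) (at z)"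
    by (auto intro!: derivative_eq_intros)
  from DERIV_chain2[OF has_field_derivative_Ln[OF one_minus_cball(3)[OF assms]] this]
  show ?thesis by simp
qed

lemma xlogx_has_derivative:
  assumes "norm z \<le> 1" "z \<noteq> 1"
  shows "(xlogx has_field_derivative xlogx_deriv z) (at z)"
proof -
  have "((\<lambda>z. 1 - z) has_field_derivative - 1) (at z)"
    by (auto intro!: derivative_eq_intros)
  from DERIV_mult[OF this Ln_one_minus_has_derivative[OF assms]]
  have "(xlogx has_field_derivative (- 1 * Ln (1 - z) + - inverse (1 - z) * (1 - z))) (at z)" .
  moreover have "- 1 * Ln (1 - z) + - inverse (1 - z) * (1 - z) = xlogx_deriv z"
    using assms(2) by simp
  ultimately show ?thesis by (simp only:)
qed

lemma continuous_on_xlogx: "continuous_on (cball 0 1) xlogx"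
proof (rule continuous_on_cball_except_1)
  show "isCont xlogx z" if "norm z \<le> 1" "z \<noteq> 1" for z
    by (rule DERIV_isCont[OF xlogx_has_derivative[OF that]])
  show "(xlogx \<longlongrightarrow> xlogx 1) (at 1)"
    using tendsto_mult_Ln by simp
qed

text \<open>The unbounded part of \<open>z * xlogx_deriv z\<close> near \<open>z = 1\<close> is \<open>- Log (1 - z)\<close>, whose imaginary part is an
  argument; the rest is bounded.\<close>

lemma xlogx_deriv_Im_bounded: "\<exists>B. \<forall>z. norm z \<le> 1 \<longrightarrow> z \<noteq> 1 \<longrightarrow> \<bar>Im (z * xlogx_deriv z)\<bar> \<le> B"
proof -
  have "bounded (xlogx ` cball 0 1)"
    by (intro compact_imp_bounded compact_continuous_image continuous_on_xlogx) auto
  then obtain K where K: "\<And>z. norm z \<le> 1 \<Longrightarrow> norm (xlogx z) \<le> K"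
    unfolding bounded_iff by (metis imageI mem_cball_0)
  have "\<bar>Im (z * xlogx_deriv z)\<bar> \<le> K + pi + 1" if z: "norm z \<le> 1" "z \<noteq> 1" for z
  proof -
    have "z * xlogx_deriv z = xlogx z - Ln (1 - z) - z" by (simp add: algebra_simps)
    then have "\<bar>Im (z * xlogx_deriv z)\<bar> \<le> \<bar>Im (xlogx z)\<bar> + \<bar>Im (Ln (1 - z))\<bar> + \<bar>Im z\<bar>"
      by (simp only: minus_complex.sel)
    moreover have "\<bar>Im (Ln (1 - z))\<bar> \<le> pi"
      using mpi_less_Im_Ln[of "1 - z"] Im_Ln_le_pi[of "1 - z"] z by auto
    ultimately show ?thesis
      using K[OF z(1)] abs_Im_le_cmod[of "xlogx z"] abs_Im_le_cmod[of z] z(1) by linarith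
  qed
  then show ?thesis by blast
qed

text \<open>The inner logarithm of the iterated logarithm below. The summand \<open>1\<close> exceeds \<open>ln 2\<close>, which keeps the real part positive
  on the closed disc, so that the principal logarithm can be applied again.\<close>

abbreviation shifted_log :: "complex \<Rightarrow> complex" where "shifted_log z \<equiv> 1 - Ln (1 - z)"

lemma Re_shifted_log_pos:
  assumes "norm z \<le> 1" "z \<noteq> 1"
  shows "1 - ln 2 \<le> Re (shifted_log z)" "0 < Re (shifted_log z)" "shifted_log z \<notin> \<real>\<^sub>\<le>\<^sub>0"
proof -
  have n: "norm (1 - z) \<le> 2" "0 < norm (1 - z)" "1 - z \<noteq> 0" using one_minus_cball[OF assms] assms(2) by auto
  have r: "Re (shifted_log z) = 1 - ln (norm (1 - z))" using n by simp
  show lo: "1 - ln 2 \<le> Re (shifted_log z)" unfolding r using n by simp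
  have "ln 2 < (1::real)" using ln_2_less_1 by simp
  then show pos: "0 < Re (shifted_log z)" using lo by linarith
  then show "shifted_log z \<notin> \<real>\<^sub>\<le>\<^sub>0" by (auto simp: complex_nonpos_Reals_iff)
qed

lemma Ln_shifted_log_has_derivative:
  assumes "norm z \<le> 1" "z \<noteq> 1"
  shows "((\<lambda>z. - \<i> * Ln (shifted_log z)) has_field_derivative (- \<i> / ((1 - z) * shifted_log z))) (at z)"
proof -
  have "((\<lambda>z. shifted_log z) has_field_derivative inverse (1 - z)) (at z)"
    using DERIV_diff[OF DERIV_const Ln_one_minus_has_derivative[OF assms]] by simp
  from DERIV_cmult[OF DERIV_chain2[OF has_field_derivative_Ln[OF Re_shifted_log_pos(3)[OF assms]] this], of "- \<i>"]
  show ?thesis by (simp add: divide_inverse mult_ac)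
qed

text \<open>The real part of \<open>shifted_log z\<close> tends to infinity at \<open>1\<close> while its imaginary part stays bounded, hence its
  argument tends to \<open>0\<close>, although its logarithm is unbounded.\<close>

lemma tendsto_Ln_shifted_log: "((\<lambda>z. Re (- \<i> * Ln (shifted_log z))) \<longlongrightarrow> 0) (at 1)"
proof -
  have "filterlim (\<lambda>z::complex. norm (1 - z)) (at_right 0) (at 1)"
    unfolding filterlim_at
    by (auto intro!: tendsto_eq_intros simp: eventually_at_filter)
  then have "filterlim (\<lambda>z::complex. ln (norm (1 - z))) at_bot (at 1)"
    by (rule filterlim_compose[OF ln_at_0])
  then have "filterlim (\<lambda>z::complex. - ln (norm (1 - z))) at_top (at 1)"
    by (simp add: filterlim_uminus_at_top)
  then have R: "filterlim (\<lambda>z::complex. 1 - ln (norm (1 - z))) at_top (at 1)"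
    using filterlim_tendsto_add_at_top[OF tendsto_const[of 1]] by fastforce
  have "((\<lambda>z. pi * inverse (1 - ln (norm (1 - z)))) \<longlongrightarrow> pi * 0) (at (1::complex))"
    by (intro tendsto_intros tendsto_inverse_0_at_top[OF R])
  then have bound_lim: "((\<lambda>z. pi * inverse (1 - ln (norm (1 - z)))) \<longlongrightarrow> 0) (at (1::complex))" by simp
  show ?thesis
  proof (rule Lim_null_comparison[OF _ bound_lim])
    have "\<forall>\<^sub>F z::complex in at 1. 1 \<le> 1 - ln (norm (1 - z))"
      using R[unfolded filterlim_at_top, rule_format, of 1] .
    moreover have "\<forall>\<^sub>F z::complex in at 1. z \<noteq> 1"
      by (simp add: eventually_at_filter)
    ultimately show "\<forall>\<^sub>F z in at 1. norm (Re (- \<i> * Ln (shifted_log z))) \<le> pi * inverse (1 - ln (norm (1 - z)))"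
    proof eventually_elim
      case (elim z)
      then have n: "1 - z \<noteq> 0" by simp
      then have R: "Re (shifted_log z) = 1 - ln (norm (1 - z))" by simp
      have I: "\<bar>Im (shifted_log z)\<bar> \<le> pi" using mpi_less_Im_Ln[OF n] Im_Ln_le_pi[OF n] by simp
      have pos: "0 < Re (shifted_log z)" using elim(1) unfolding R by linarith
      then have "shifted_log z \<noteq> 0" by force
      then have "Im (Ln (shifted_log z)) = arctan (Im (shifted_log z) / Re (shifted_log z))"
        using Im_Ln_eq[of "shifted_log z"] pos by (simp del: minus_complex.sel)
      then have "norm (Re (- \<i> * Ln (shifted_log z))) \<le> \<bar>Im (shifted_log z) / Re (shifted_log z)\<bar>"
        using abs_arctan_le[of "Im (shifted_log z) / Re (shifted_log z)"] by (simp del: minus_complex.sel)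
      also have "\<dots> = \<bar>Im (shifted_log z)\<bar> * inverse (Re (shifted_log z))"
        using pos by (simp add: divide_inverse abs_mult del: minus_complex.sel)
      also have "\<dots> \<le> pi * inverse (Re (shifted_log z))"
        using I pos by (intro mult_right_mono) auto
      finally show ?case unfolding R .
    qed
  qed
qed

text \<open>At \<open>1\<close> the formula would involve the logarithm of \<open>0\<close>. The value \<open>0\<close> is the limit of the real part there, which
  makes the real part continuous on the closed disc.\<close>

definition loglog :: "complex \<Rightarrow> complex" where
  "loglog z = (if z = 1 then 0 else - \<i> * Ln (shifted_log z))"

lemma loglog_has_derivative:
  assumes "norm z \<le> 1" "z \<noteq> 1"
  shows "(loglog has_field_derivative (- \<i> / ((1 - z) * shifted_log z))) (at z)"
proof (rule has_field_derivative_transform_within_open[OF Ln_shifted_log_has_derivative[OF assms]])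
  show "open (- {1 :: complex})" by (simp add: open_Compl)
qed (use assms in \<open>simp_all add: loglog_def\<close>)

lemma continuous_on_Re_loglog: "continuous_on (cball 0 1) (\<lambda>z. Re (loglog z))"
proof (rule continuous_on_cball_except_1)
  show "isCont (\<lambda>z. Re (loglog z)) z" if "norm z \<le> 1" "z \<noteq> 1" for z
    by (intro isCont_Re DERIV_isCont[OF loglog_has_derivative[OF that]])
  have "\<forall>\<^sub>F z in at 1. Re (- \<i> * Ln (shifted_log z)) = Re (loglog z)"
    by (simp add: eventually_at_filter loglog_def)
  then show "((\<lambda>z. Re (loglog z)) \<longlongrightarrow> Re (loglog 1)) (at 1)"
    using tendsto_Ln_shifted_log by (subst tendsto_cong[symmetric, where f = "\<lambda>z. Re (- \<i> * Ln (shifted_log z))"]) (auto simp: loglog_def)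
qed

text \<open>With \<open>w = 1 - z\<close> and \<open>l = shifted_log z = 1 - Log w\<close>, the left-hand side is \<open>Re (1 / l) - Re (1 / (w l))\<close>. The
  second term is the singular one and has the good sign: \<open>Re (w l)\<close> is
  \<open>Re w * Re l + Im w * Arg w\<close>, where \<open>Re w\<close> and \<open>Re l\<close> are positive and \<open>Im w\<close> and \<open>Arg w\<close> have the same sign.\<close>

lemma Im_loglog_derivative_le:
  assumes z: "norm z = 1" "z \<noteq> 1"
  shows "Im (z * (- \<i> / ((1 - z) * shifted_log z))) \<le> 1 / (1 - ln 2)"
proof -
  define w where "w = 1 - z"
  have w: "0 < Re w" "w \<noteq> 0" using one_minus_cball[of z] z by (auto simp: w_def)
  have L: "shifted_log z \<noteq> 0" "1 - ln 2 \<le> Re (shifted_log z)" "0 < Re (shifted_log z)" using Re_shifted_log_pos[of z] z by auto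
  have eq0: "z * (- \<i> / ((1 - z) * shifted_log z)) = - \<i> * (1 / (w * shifted_log z)) + \<i> * (1 / shifted_log z)"
  proof -
    have "(1 - w) * (- \<i> / (w * l)) = - \<i> * (1 / (w * l)) + \<i> * (1 / l)" if "l \<noteq> 0" for l
      using w(2) that by (simp add: field_simps)
    from this[OF L(1)] show ?thesis by (simp add: w_def)
  qed
  have eq: "Im (z * (- \<i> / ((1 - z) * shifted_log z))) = Re (1 / shifted_log z) - Re (1 / (w * shifted_log z))"
  proof -
    have "Im (- \<i> * a + \<i> * b) = Re b - Re a" for a b by simp
    then show ?thesis by (metis eq0)
  qed
  have "0 \<le> Im w * Im (Ln w)"
  proof (cases "0 \<le> Im w")
    case True
    then show ?thesis using Im_Ln_pos_le[OF w(2)] by simp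
  next
    case False
    then have "Im (Ln w) < 0" using Im_Ln_pos_le[OF w(2)] Im_Ln_le_pi[OF w(2)] by linarith
    then show ?thesis using False by (simp add: mult_nonpos_nonpos)
  qed
  moreover have "Re (w * shifted_log z) = Re w * Re (shifted_log z) + Im w * Im (Ln w)"
    by (simp add: w_def)
  moreover have "0 \<le> Re w * Re (shifted_log z)" using w(1) L(3) by (intro mult_nonneg_nonneg) (simp_all del: minus_complex.sel)
  ultimately have "0 \<le> Re (w * shifted_log z)" by linarith
  then have "0 \<le> Re (1 / (w * shifted_log z))"
    by (simp add: Re_divide del: times_complex.sel)
  moreover have "Re (1 / shifted_log z) \<le> 1 / (1 - ln 2)"
  proof -
    have "Re (1 / shifted_log z) \<le> norm (1 / shifted_log z)" by (rule complex_Re_le_cmod)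
    also have "\<dots> = 1 / norm (shifted_log z)" by (simp add: norm_divide)
    also have "\<dots> \<le> 1 / (1 - ln 2)"
      using L(2) complex_Re_le_cmod[of "shifted_log z"] ln_2_less_1 by (intro divide_left_mono mult_pos_pos) auto
    finally show ?thesis .
  qed
  ultimately show ?thesis unfolding eq by linarith
qed

text \<open>On the real axis \<open>Im loglog = - ln (1 - ln (1 - x))\<close>, which tends to minus infinity as \<open>x \<rightarrow> 1\<close>.\<close>

lemma loglog_conjugate_unbounded:
  "\<exists>r\<in>{0<..<1}. M \<le> Im (loglog (- complex_of_real r)) - Im (loglog (complex_of_real r))"
proof -
  define m where "m = max M 1"
  \<comment> \<open>This choice makes \<open>ln (1 - ln (1 - r)) = m\<close>; the maximum with \<open>1\<close> ensures \<open>r > 0\<close>.\<close>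
  define r where "r = 1 - exp (1 - exp m)"
  have "1 < exp m" by (simp add: m_def)
  then have r: "0 < r" "r < 1" by (auto simp: r_def)
  have "1 - complex_of_real r = complex_of_real (exp (1 - exp m))" by (simp add: r_def)
  then have "Ln (1 - complex_of_real r) = complex_of_real (1 - exp m)"
    by (simp only: Ln_of_real[OF exp_gt_zero] ln_exp)
  then have Lr: "shifted_log (complex_of_real r) = complex_of_real (exp m)" by simp
  have "1 - - complex_of_real r = complex_of_real (1 + r)" by simp
  moreover have "Ln (complex_of_real (1 + r)) = complex_of_real (ln (1 + r))"
    using r by (intro Ln_of_real) simp
  ultimately have Lmr: "shifted_log (- complex_of_real r) = complex_of_real (1 - ln (1 + r))"
    by (simp only: of_real_diff of_real_1)
  have "ln (1 + r) \<le> ln 2" using r by simp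
  then have mr: "0 < 1 - ln (1 + r)" "1 - ln (1 + r) \<le> 1" using ln_2_less_1 ln_ge_zero[of "1 + r"] r by linarith+
  have "Im (loglog (- complex_of_real r)) - Im (loglog (complex_of_real r)) = m - ln (1 - ln (1 + r))"
  proof -
    have "- complex_of_real r \<noteq> 1" "complex_of_real r \<noteq> 1" using r by (auto simp: complex_eq_iff)
    then show ?thesis
      using mr unfolding loglog_def Lr Lmr Ln_of_real[OF exp_gt_zero] Ln_of_real[OF mr(1)] by simp
  qed
  moreover have "ln (1 - ln (1 + r)) \<le> 0" using mr by simp
  ultimately show ?thesis using r by (intro bexI[of _ r]) (auto simp: m_def)
qed

section \<open>The blow-up theorem\<close>

theorem theorem1p2:
  fixes \<alpha> :: real and p :: ereal
  assumes "(\<alpha>, p) \<in> \<Pi>\<^sub>2 \<union> \<Pi>\<^sub>3"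
  shows "\<exists>F :: complex \<Rightarrow> complex.
    abs_continuous_circle F \<and> in_Lp_circle p (circle_deriv F) \<and>
    hardy_norm p (partial_r (poisson_integral \<alpha> F)) = \<infinity> \<and>
    hardy_norm p (partial_z (poisson_integral \<alpha> F)) = \<infinity> \<and>
    hardy_norm p (partial_zbar (poisson_integral \<alpha> F)) = \<infinity>"
proof -
  consider (neg) "-1 < \<alpha>" "\<alpha> < 0" "0 < p" | (one) "\<alpha> = 0" "p = 1" | (inf) "\<alpha> = 0" "p = \<infinity>"
  proof -
    have "0 < p" if "-1 < \<alpha>" "\<alpha> < 0" "ereal (- 1 / \<alpha>) \<le> p"
    proof -
      have "0 < ereal (- 1 / \<alpha>)" using that by (simp add: divide_neg_neg)
      then show ?thesis using that(3) by (rule less_le_trans)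
    qed
    moreover have "0 < p" if "1 \<le> p"
      using that by (rule less_le_trans[rotated]) simp
    ultimately show thesis
      using assms that unfolding \<Pi>\<^sub>2_def \<Pi>\<^sub>3_def by auto
  qed
  then show ?thesis
  proof cases
    case neg
    have "hardy_norm p g = \<infinity>"
      if "g \<in> {partial_r (poisson_integral \<alpha> (\<lambda>_. 1)), partial_z (poisson_integral \<alpha> (\<lambda>_. 1)),
        partial_zbar (poisson_integral \<alpha> (\<lambda>_. 1))}" for g
      using neg that by (rule hardy_norm_poisson_integral_one)
    then show ?thesis
      by (intro exI[of _ "\<lambda>_. 1"] conjI abs_continuous_circle_const in_Lp_circle_deriv_const) auto
  next
    case one
    define F where "F = (\<lambda>z. complex_of_real (Re (loglog z)))"
    note der = loglog_has_derivative
    have "abs_continuous_circle F" "in_Lp_circle 1 (circle_deriv F)"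
      unfolding F_def by (rule harmonic_boundary_regularity[OF der continuous_on_Re_loglog Im_loglog_derivative_le]; assumption)+
    moreover have "hardy_norm 1 g = \<infinity>"
      if "g \<in> {partial_r (poisson_integral 0 F), partial_z (poisson_integral 0 F), partial_zbar (poisson_integral 0 F)}" for g
      by (rule hardy_norm_1_conjugate_unbounded[OF der continuous_on_Re_loglog loglog_conjugate_unbounded that[unfolded F_def]]) auto
    ultimately show ?thesis using one by (intro exI[of _ F]) auto
  next
    case inf
    define F where "F = (\<lambda>z. complex_of_real (Re (xlogx z)))"
    note der = xlogx_has_derivative
    have cont: "continuous_on (cball 0 1) (\<lambda>z. Re (xlogx z))"
      by (intro continuous_on_Re continuous_on_xlogx)
    have der_disc: "(xlogx has_field_derivative xlogx_deriv z) (at z)" if "norm z < 1" for z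
      using that by (intro der) auto
    obtain B where B: "\<And>z. norm z \<le> 1 \<Longrightarrow> z \<noteq> 1 \<Longrightarrow> \<bar>Im (z * xlogx_deriv z)\<bar> \<le> B"
      using xlogx_deriv_Im_bounded by blast
    have upper: "Im (z * xlogx_deriv z) \<le> B" and lower: "- B \<le> Im (z * xlogx_deriv z)"
      if "norm z = 1" "z \<noteq> 1" for z
      using abs_le_D1[OF B[of z]] abs_le_D2[OF B[of z]] that by simp_all
    have "abs_continuous_circle F" "in_Lp_circle \<infinity> (circle_deriv F)"
      unfolding F_def
      by (rule harmonic_boundary_regularity[OF der cont upper]; use lower in blast)+
    moreover have "hardy_norm \<infinity> g = \<infinity>"
      if g: "g \<in> {partial_r (poisson_integral 0 F), partial_z (poisson_integral 0 F), partial_zbar (poisson_integral 0 F)}" for g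
    proof (rule hardy_norm_infinity_unbounded)
      fix M :: real
      define m where "m = max M 0"
      \<comment> \<open>This choice makes \<open>- ln (1 - r) - 1 = 2 * m\<close>.\<close>
      define r where "r = 1 - exp (- (2 * m + 1))"
      have "exp (- (2 * m + 1)) < 1" by (simp add: m_def)
      then have r: "0 < r" "r < 1" by (auto simp: r_def)
      have "1 - complex_of_real r = complex_of_real (exp (- (2 * m + 1)))" by (simp add: r_def)
      then have "Ln (1 - complex_of_real r) = complex_of_real (- (2 * m + 1))"
        by (simp only: Ln_of_real[OF exp_gt_zero] ln_exp)
      then have "2 * m = Re (xlogx_deriv (complex_of_real r * cis 0) * cis 0)" by simp
      also have "\<dots> \<le> 2 * norm (g (complex_of_real r * cis 0))"
        using harmonic_wirtinger_ge_radial[OF der_disc cont g[unfolded F_def] r, of 0] by linarith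
      finally have "M \<le> norm (g (complex_of_real r * cis 0))" by (simp add: m_def)
      then show "\<exists>r\<in>{0..<1}. \<exists>t\<in>{0..2*pi}. M \<le> norm (g (complex_of_real r * cis t))"
        using r by (intro bexI[of _ r] bexI[of _ 0]) auto
    qed
    ultimately show ?thesis using inf by (intro exI[of _ F]) auto
  qed
qed

end
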